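(* Let $G$ be a planar bipartite graph, $D$ its dual alternating dimap, and $L=L_G$ the associated positive special alternating link. Let $r\in V(D)$ denote the vertex corresponding to the exterior region of $L$. Fix $e_0\in E(D)$ with $\mathrm{fin}(e_0)=r$. Let $v=v_{e_0}\in V(\overrightarrow{\mathcal G(L)})$, and let $f_v\in E(\overrightarrow{\mathcal G(L)})$ be the unique edge in the boundary of the exterior region such that $\mathrm{fin}(f_v)=v$. Then $F=\Psi_{v,f_v}\circ\Phi$ is a bijection between the set $\mathcal T(D)$ of spanning trees of $D$ and the set $\mathcal A_v(\overrightarrow{\mathcal G(L)})$ of arborescences of $\overrightarrow{\mathcal G(L)}$ rooted at $v$. Moreover, $$\mathrm{wt}_C(A)=\mathrm{wt}_K(T)\,t^{m_2-1},$$ where $T\in\mathcal T(D)$, $A=F(T)\in\mathcal A_v(\overrightarrow{\mathcal G(L)})$, and $m_2$ is the number of blue regions of $\overrightarrow{\mathcal G(L)}$.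
   Context: For a directed edge $e$, $\mathrm{init}(e)$ and $\mathrm{fin}(e)$ are its initial and final vertices. The link $L_G$: $G$ is a planar bipartite graph with a fixed planar drawing and $D$ is its planar dual, oriented so that around each vertex the edges alternate between incoming and outgoing (an alternating dimap). The medial graph $M(G)$ has a vertex at the midpoint of each edge of $G$, two being joined by an edge whenever the corresponding edges of $G$ are consecutive in the boundary of a face of $G$. The vertex of $M(G)$ where the edge $e$ of $D$ crosses its dual edge of $G$ is denoted $v_e$. Each region of $M(G)$ corresponds to a vertex of $G$ (a "$G$-region") or to a vertex of $D$ (a "$D$-region"). Partition the $G$-regions into classes $\mathsf A,\mathsf B$ so that each edge of $D$, traveling in its direction through a vertex of $M(G)$, passes a region in $\mathsf A$ on the left and a region in $\mathsf B$ on the right. Orient the edges of $M(G)$ so that the boundary of each region in $\mathsf A$ is a counterclockwise cycle and of each region in $\mathsf B$ a clockwise cycle, and turn every vertex into a positive crossing (rotating so that the over-strand runs left to right, the under-strand runs bottom to top). This gives an alternating diagram of $L_G$. Its exterior region is a $D$-region. The digraph $\overrightarrow{\mathcal G(L)}$ (Crowell's model): its underlying graph is $M(G)$ (vertices = crossings, edges = arcs between crossings). At each crossing, the two edges on the under-strand are directed into the crossing and the two edges on the over-strand are directed out of it. Each edge carries a weight $\mathrm{var}(\cdot)$: at the crossing it enters, it has weight $1$ if it lies to the left of the over-strand (with the over-strand's orientation as part of $L$) and weight $-t$ if it lies to the right. Each $G$-region is bounded by a clockwise directed cycle of $\overrightarrow{\mathcal G(L)}$, on which all edges have the same weight; it is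 called gold if this weight is $-t$ and blue if it is $1$. An arborescence of $\overrightarrow{\mathcal G(L)}$ rooted at $v$ is a spanning tree with a unique directed path from $v$ to every other vertex. Its Crowell weight is $\mathrm{wt}_C(A)=\prod_{e\in E(A)}\mathrm{var}(e)$. For a spanning tree $T$ of $D$, $E_{\mathrm{away}}(T)\subset E(T)$ is the set of edges such that reversing the orientation of all of them makes $T$ an oriented spanning tree rooted at $r$ (every vertex has a unique directed path to $r$); the Kauffman weight is $\mathrm{wt}_K(T)=t^{|E(T)\setminus E_{\mathrm{away}}(T)|}$. The map $\Phi$ sends $T\in\mathcal T(D)$ to an Eulerian tour of $\overrightarrow{\mathcal G(L)}$ (a closed directed trail using each edge exactly once), regarded as beginning with $f_v$, defined by the following pairing at each vertex $v_e$. Around $v_e$ the four edges alternate in/out, and the four corners alternate between $G$-regions and $D$-regions. If $e\in E(T)$, each incoming edge is followed by the outgoing edge with which it bounds a corner of a $G$-region at $v_e$ (so the tour runs alongside $e$ without crossing it); if $e\notin E(T)$, each incoming edge is followed by the outgoing edge with which it bounds a corner of a $D$-region at $v_e$. The map $\Psi_{v,f_v}$ sends an Eulerian tour $C$ beginning with $f_v$ to the subgraph formed by selecting, for each vertex $u\neq v$ of $\overrightarrow{\mathcal G(L)}$, the first edge of $C$ whose final vertex is $u$.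
   Formalization: The weight identity as printed fails (already for the Hopf link); it is proved with var equal to -t on the left and 1 on the right of the over-strand (blue still means weight 1), and with -t substituted for t in wt_C(A). If e_0 is a loop, f_v is not unique; any choice is allowed. *)

theory Defs
  imports
    "HOL-Combinatorics.Orbits"
    "HOL-Computational_Algebra.Polynomial"
    "Graph_Theory.Euler"
begin

section \<open>Plane maps\<close>

text \<open>
  A graph (multigraph) drawn on an oriented surface is encoded by its darts (half-edges): \<open>rot\<close>
  sends a dart to the next one counterclockwise around its initial vertex, \<open>opp\<close> sends it to
  the other half of its edge. Vertices and faces are orbits; the face permutation walks along a face
  keeping it on the left, so \<open>face M d\<close> is the face to the left of \<open>d\<close>, and it contains the corner
  running counterclockwise from \<open>d\<close> to \<open>rot M d\<close>.
\<close>

record 'a cmap =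
  darts :: "'a set"
  rot :: "'a \<Rightarrow> 'a"
  opp :: "'a \<Rightarrow> 'a"

definition wf_cmap :: "'a cmap \<Rightarrow> bool" where
  "wf_cmap M \<longleftrightarrow> finite (darts M) \<and> rot M permutes darts M \<and> opp M permutes darts M
     \<and> (\<forall>d\<in>darts M. opp M d \<noteq> d \<and> opp M (opp M d) = d)"

definition vertex :: "'a cmap \<Rightarrow> 'a \<Rightarrow> 'a set" where
  "vertex M d = orbit (rot M) d"

definition vertices :: "'a cmap \<Rightarrow> 'a set set" where
  "vertices M = vertex M ` darts M"

definition edges :: "'a cmap \<Rightarrow> 'a set set" where
  "edges M = (\<lambda>d. {d, opp M d}) ` darts M"

definition face_perm :: "'a cmap \<Rightarrow> 'a \<Rightarrow> 'a" where
  "face_perm M d = inv (rot M) (opp M d)"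

definition face :: "'a cmap \<Rightarrow> 'a \<Rightarrow> 'a set" where
  "face M d = orbit (face_perm M) d"

definition faces :: "'a cmap \<Rightarrow> 'a set set" where
  "faces M = face M ` darts M"

text \<open>The digraph on the vertices of \<open>M\<close> whose arcs are the darts in \<open>E\<close>, each directed away from
  the vertex it is attached to. Taking one dart of each edge gives an orientation of the graph;
  taking all darts gives the graph as a symmetric digraph.\<close>

definition map_digraph :: "'a cmap \<Rightarrow> 'a set \<Rightarrow> ('a set, 'a) pre_digraph" where
  "map_digraph M E = \<lparr> verts = vertices M, arcs = E,
     tail = vertex M, head = (\<lambda>d. vertex M (opp M d)) \<rparr>"

definition plane_map :: "'a cmap \<Rightarrow> bool" where
  "plane_map M \<longleftrightarrow> wf_cmap M \<and> Digraph_Component.connected (map_digraph M (darts M))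
     \<and> int (card (vertices M)) - int (card (edges M)) + int (card (faces M)) = 2"

definition bipartite_map :: "'a cmap \<Rightarrow> bool" where
  "bipartite_map M \<longleftrightarrow> (\<exists>X. \<forall>d\<in>darts M. vertex M d \<in> X \<longleftrightarrow> vertex M (opp M d) \<notin> X)"

text \<open>The planar dual has the same darts: as a dart of the dual, \<open>d\<close> starts at the face to the left
  of \<open>d\<close> and crosses \<open>d\<close> from left to right. Hence it passes the end \<open>vertex G (opp G d)\<close> of the
  crossed edge on its left and the end \<open>vertex G d\<close> on its right.\<close>

definition dual_map :: "'a cmap \<Rightarrow> 'a cmap" where
  "dual_map M = \<lparr> darts = darts M, rot = face_perm M, opp = opp M \<rparr>"

definition alternating_dimap :: "'a cmap \<Rightarrow> 'a set \<Rightarrow> bool" where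
  "alternating_dimap M E \<longleftrightarrow> E \<subseteq> darts M
     \<and> (\<forall>d\<in>darts M. d \<in> E \<longleftrightarrow> opp M d \<notin> E)
     \<and> (\<forall>d\<in>darts M. d \<in> E \<longleftrightarrow> rot M d \<notin> E)"


section \<open>The medial graph\<close>

text \<open>
  Standing at the midpoint of an edge of \<open>G\<close> and looking back along the dart \<open>d\<close> towards the vertex
  \<open>d\<close> starts from, there is one medial half-edge in the corner on each side of \<open>d\<close>. It is encoded as
  \<open>(d, Lft)\<close> or \<open>(d, Rgt)\<close>, where left and right are those of the direction of \<open>d\<close>. The medial
  vertex on an edge thus carries, counterclockwise, \<open>(d, Lft)\<close>, \<open>(d, Rgt)\<close>, \<open>(opp d, Lft)\<close>,
  \<open>(opp d, Rgt)\<close>. The medial edge through the corner from \<open>d\<close> to \<open>rot d\<close> consists of the half-edges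
  \<open>(d, Lft)\<close> and \<open>(rot d, Rgt)\<close>.
\<close>

datatype side = Lft | Rgt

fun medial_rot :: "'a cmap \<Rightarrow> 'a \<times> side \<Rightarrow> 'a \<times> side" where
  "medial_rot G (d, Lft) = (if d \<in> darts G then (d, Rgt) else (d, Lft))"
| "medial_rot G (d, Rgt) = (if d \<in> darts G then (opp G d, Lft) else (d, Rgt))"

fun medial_opp :: "'a cmap \<Rightarrow> 'a \<times> side \<Rightarrow> 'a \<times> side" where
  "medial_opp G (d, Lft) = (if d \<in> darts G then (rot G d, Rgt) else (d, Lft))"
| "medial_opp G (d, Rgt) = (if d \<in> darts G then (inv (rot G) d, Lft) else (d, Rgt))"

definition medial :: "'a cmap \<Rightarrow> ('a \<times> side) cmap" where
  "medial G = \<lparr> darts = darts G \<times> UNIV, rot = medial_rot G, opp = medial_opp G \<rparr>"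

text \<open>The medial vertex \<open>v\<^sub>e\<close> on the edge crossed by the dual edge \<open>e\<close>.\<close>

definition crossing :: "'a cmap \<Rightarrow> 'a \<Rightarrow> ('a \<times> side) set" where
  "crossing G e = vertex (medial G) (e, Lft)"

text \<open>The regions of the medial graph (elements of \<open>faces (medial G)\<close>) corresponding to a vertex
  \<open>u\<close> of \<open>G\<close>, respectively to a vertex \<open>w\<close> of the dual, that is, to a face of \<open>G\<close>.\<close>

definition G_region :: "'a set \<Rightarrow> ('a \<times> side) set" where
  "G_region u = (\<lambda>d. (d, Lft)) ` u"

definition D_region :: "'a cmap \<Rightarrow> 'a set \<Rightarrow> ('a \<times> side) set" where
  "D_region G w = (\<lambda>d. (opp G d, Rgt)) ` w"

definition G_regions :: "'a cmap \<Rightarrow> ('a \<times> side) set set" where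
  "G_regions G = G_region ` vertices G"

definition D_regions :: "'a cmap \<Rightarrow> ('a \<times> side) set set" where
  "D_regions G = D_region G ` vertices (dual_map G)"


section \<open>The link diagram\<close>

text \<open>From here on \<open>E\<close> is the set of darts of \<open>dual_map G\<close> that orients the dual.\<close>

definition class_A :: "'a cmap \<Rightarrow> 'a set \<Rightarrow> ('a \<times> side) set set" where
  "class_A G E = (\<lambda>e. G_region (vertex G (opp G e))) ` E"

definition class_B :: "'a cmap \<Rightarrow> 'a set \<Rightarrow> ('a \<times> side) set set" where
  "class_B G E = (\<lambda>e. G_region (vertex G e)) ` E"

text \<open>A medial dart points in the direction of the link if it has a region of \<open>class_A\<close> on its left
  (this makes the boundary counterclockwise) or a region of \<open>class_B\<close> on its right (clockwise).\<close>

definition link_out :: "'a cmap \<Rightarrow> 'a set \<Rightarrow> 'a \<times> side \<Rightarrow> bool" where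
  "link_out G E h \<longleftrightarrow> face (medial G) h \<in> class_A G E
     \<or> face (medial G) (opp (medial G) h) \<in> class_B G E"

text \<open>At a positive crossing, seen with the over-strand running from left to right and the
  under-strand from bottom to top, the half-edges in counterclockwise order are: over and outgoing
  (right), under and outgoing (top), over and incoming (left), under and incoming (bottom). So a
  half-edge is over iff its counterclockwise successor has the same in/out status, and an
  under half-edge is to the left of the over-strand iff its successor is incoming.\<close>

definition over :: "'a cmap \<Rightarrow> 'a set \<Rightarrow> 'a \<times> side \<Rightarrow> bool" where
  "over G E h \<longleftrightarrow> (link_out G E h \<longleftrightarrow> link_out G E (rot (medial G) h))"

definition left_of_over :: "'a cmap \<Rightarrow> 'a set \<Rightarrow> 'a \<times> side \<Rightarrow> bool" where
  "left_of_over G E h \<longleftrightarrow> \<not> over G E h \<and> \<not> link_out G E (rot (medial G) h)"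


section \<open>Crowell's digraph\<close>

text \<open>The diagram is alternating, so exactly one of the two darts of a medial edge starts as over-strand
  and ends as under-strand; this dart represents the edge in its direction in Crowell's digraph.\<close>

definition crowell_arcs :: "'a cmap \<Rightarrow> 'a set \<Rightarrow> ('a \<times> side) set" where
  "crowell_arcs G E =
     {h \<in> darts (medial G). over G E h \<and> \<not> over G E (opp (medial G) h)}"

definition crowell_digraph ::
  "'a cmap \<Rightarrow> 'a set \<Rightarrow> (('a \<times> side) set, 'a \<times> side) pre_digraph" where
  "crowell_digraph G E = map_digraph (medial G) (crowell_arcs G E)"

abbreviation t_var :: "int poly" where
  "t_var \<equiv> [:0, 1:]"

text \<open>
  Convention: of the two edges entering a crossing, the one to the left of the over-strand has weight
  \<open>- t\<close> and the one to the right has weight \<open>1\<close>. With the orientations fixed above, the opposite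
  choice is incompatible with the exponent of \<open>wt_K\<close> below: for the Hopf link (two vertices, two
  parallel edges) the tree consisting of \<open>e\<^sub>0\<close> has \<open>wt_K\<close> equal to \<open>t\<close>, there is one region of weight
  \<open>1\<close>, and the opposite choice gives the corresponding arborescence the weight \<open>1\<close>.
\<close>

definition var :: "'a cmap \<Rightarrow> 'a set \<Rightarrow> 'a \<times> side \<Rightarrow> int poly" where
  "var G E h = (if left_of_over G E (opp (medial G) h) then - t_var else 1)"

definition boundary_arcs :: "'a cmap \<Rightarrow> 'a set \<Rightarrow> ('a \<times> side) set \<Rightarrow> ('a \<times> side) set" where
  "boundary_arcs G E R = {h \<in> crowell_arcs G E. h \<in> R \<or> opp (medial G) h \<in> R}"

definition blue_regions :: "'a cmap \<Rightarrow> 'a set \<Rightarrow> ('a \<times> side) set set" where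
  "blue_regions G E = {R \<in> G_regions G. \<forall>h\<in>boundary_arcs G E R. var G E h = 1}"

text \<open>This product carries the sign of \<open>(- t)\<close> to the number of its non-blue edges, whereas \<open>wt_K\<close>
  below is a power of \<open>t\<close>; the two are to be compared after substituting \<open>- t\<close> for \<open>t\<close> in \<open>wt_C\<close>.\<close>

definition wt_C :: "'a cmap \<Rightarrow> 'a set \<Rightarrow> ('a \<times> side) set \<Rightarrow> int poly" where
  "wt_C G E A = (\<Prod>h\<in>A. var G E h)"


section \<open>Spanning trees and arborescences\<close>

text \<open>Spanning subgraphs are represented by their arc sets. The library's \<open>forest\<close> and \<open>tree\<close>
  exclude only directed cycles, so acyclicity of the underlying multigraph is expressed
  by letting every arc be traversed in both directions (but at most once).\<close>

definition two_way :: "('v, 'e) pre_digraph \<Rightarrow> ('v, 'e \<times> bool) pre_digraph" where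
  "two_way H = \<lparr> verts = verts H, arcs = arcs H \<times> UNIV,
     tail = (\<lambda>(e, b). if b then tail H e else head H e),
     head = (\<lambda>(e, b). if b then head H e else tail H e) \<rparr>"

definition undirected_forest :: "('v, 'e) pre_digraph \<Rightarrow> bool" where
  "undirected_forest H \<longleftrightarrow> \<not> (\<exists>p. pre_digraph.cycle (two_way H) p \<and> distinct (map fst p))"

definition spanning_trees :: "('v, 'e) pre_digraph \<Rightarrow> 'e set set" where
  "spanning_trees H = {T. T \<subseteq> arcs H \<and> Digraph_Component.connected (H\<lparr>arcs := T\<rparr>)
     \<and> undirected_forest (H\<lparr>arcs := T\<rparr>)}"

definition arborescences :: "('v, 'e) pre_digraph \<Rightarrow> 'v \<Rightarrow> 'e set set" where
  "arborescences H v = {A \<in> spanning_trees H.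
     \<forall>u\<in>verts H - {v}. \<exists>!p. pre_digraph.apath (H\<lparr>arcs := A\<rparr>) v p u}"

definition reverse_arcs :: "'e set \<Rightarrow> ('v, 'e) pre_digraph \<Rightarrow> ('v, 'e) pre_digraph" where
  "reverse_arcs R H = H\<lparr> tail := (\<lambda>e. if e \<in> R then head H e else tail H e),
     head := (\<lambda>e. if e \<in> R then tail H e else head H e) \<rparr>"

definition E_away :: "('v, 'e) pre_digraph \<Rightarrow> 'v \<Rightarrow> 'e set \<Rightarrow> 'e set" where
  "E_away H r T = (THE R. R \<subseteq> T \<and>
     (\<forall>u\<in>verts H. \<exists>!p. pre_digraph.apath (reverse_arcs R (H\<lparr>arcs := T\<rparr>)) u p r))"

definition wt_K :: "('v, 'e) pre_digraph \<Rightarrow> 'v \<Rightarrow> 'e set \<Rightarrow> int poly" where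
  "wt_K H r T = t_var ^ card (T - E_away H r T)"


section \<open>The maps between trees, tours and arborescences\<close>

definition euler_tours_from :: "('v, 'e) pre_digraph \<Rightarrow> 'e \<Rightarrow> 'e list set" where
  "euler_tours_from H f =
     {C. C \<noteq> [] \<and> hd C = f \<and> (\<exists>u. pre_digraph.euler_trail H u C u)}"

text \<open>Two half-edges bound a corner of a region if one is the counterclockwise successor
  of the other and the corner between them belongs to that region.\<close>

definition bound_corner :: "'a cmap \<Rightarrow> 'a \<Rightarrow> 'a \<Rightarrow> 'a set \<Rightarrow> bool" where
  "bound_corner M h k R \<longleftrightarrow>
     (rot M h = k \<and> face M h = R) \<or> (rot M k = h \<and> face M k = R)"

definition next_arc :: "'a cmap \<Rightarrow> 'a set \<Rightarrow> 'a set \<Rightarrow> 'a \<times> side \<Rightarrow> 'a \<times> side" where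
  "next_arc G E T f = (THE g. g \<in> crowell_arcs G E \<and>
     (\<exists>R \<in> (if \<exists>e\<in>T. head (crowell_digraph G E) f = crossing G e
            then G_regions G else D_regions G).
        bound_corner (medial G) (opp (medial G) f) g R))"

definition Phi :: "'a cmap \<Rightarrow> 'a set \<Rightarrow> 'a \<times> side \<Rightarrow> 'a set \<Rightarrow> ('a \<times> side) list" where
  "Phi G E f T = map (\<lambda>i. (next_arc G E T ^^ i) f) [0..<card (crowell_arcs G E)]"

definition Psi :: "('v, 'e) pre_digraph \<Rightarrow> 'v \<Rightarrow> 'e list \<Rightarrow> 'e set" where
  "Psi H v C = (\<lambda>u. hd (filter (\<lambda>e. head H e = u) C)) ` (verts H - {v})"

end

theory Submission
  imports Defs
begin

text \<open>Write \<open>\<sigma>\<close> and \<open>\<alpha>\<close> for the rotation and the involution of \<open>G\<close>. The alternation of the dual says that \<open>E\<close>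
consists of all darts that start at the vertices of one colour class of \<open>G\<close>. Crowell's digraph then
has one arc \<open>arc x\<close> for each dart \<open>x\<close>: it runs around the vertex of \<open>x\<close> from the crossing on the
edge of \<open>\<sigma> x\<close> to the crossing on the edge of \<open>x\<close>, and its weight is \<open>1\<close> if \<open>x \<in> E\<close> and \<open>- t\<close>
otherwise. Every crossing has two incoming arcs, \<open>arc x\<close> and \<open>arc (\<alpha> x)\<close>, and for \<open>T \<subseteq> E\<close> the
pairing that defines \<open>Phi\<close> sends \<open>arc x\<close> to \<open>arc (contour_step T x)\<close>. The permutation
\<open>contour_step T\<close> walks along the contour of the subgraph \<open>T\<close> of the dual: it runs alongside the edges
in \<open>T\<close> and cuts through all others.

\<^bold>\<open>Spanning trees and tours.\<close> Adding an edge \<open>e\<close> to \<open>T\<close> composes the contour permutation with the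
transposition of \<open>e\<close> and \<open>\<alpha> e\<close>. As long as \<open>T\<close> remains a forest, the two darts lie in different
components of \<open>T\<close> and hence in different cycles, which the transposition merges. So the cycles are the
components, and a spanning tree has a single contour
(\<open>contour_invariant_respects_components\<close>, \<open>spanning_tree_contour_cyclic\<close>). Conversely, follow a
contour that is a single cycle. Every face but the initial one is entered for the first time
across an edge in \<open>T\<close>, and every vertex of \<open>G\<close> but the initial one across an edge outside \<open>T\<close>. By
Euler's formula there are exactly as many edges as such first passages, so both correspondences are
bijections (\<open>passages_bij\<close>). Hence \<open>T\<close> is a tree which grows from the initial face in the order of
the first visits (\<open>dual_ranked_tree\<close>).

\<^bold>\<open>Tours and arborescences.\<close> This is the argument of the BEST theorem. A crossing is entered for the
first time from a crossing that was visited before, so the first entries form an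
arborescence (\<open>crossing_ranked_tree\<close>). Backwards in time, a crossing is met first through its last entry and
then through its first entry, which is the arc in the arborescence or, at the root, the starting arc.
So the arborescence determines the tour step by step
(\<open>contour_determined_by_first_darts\<close>). For a given arborescence the same rule constructs a backward
walk. It closes up at the root, and it misses no dart because every crossing is reachable from the root
in the arborescence (\<open>arborescence_from_tour\<close>).

\<^bold>\<open>Weights.\<close> The substitution of \<open>- t\<close> turns the weight of the arborescence into \<open>t\<close> to the number of
first entries \<open>x \<notin> E\<close> other than the starting dart \<open>x0\<close>. On an edge in \<open>T\<close> the first entry leads away
from \<open>r\<close>, so it is outside \<open>E\<close> iff the arc on this edge points towards \<open>r\<close>: these are counted by \<open>wt_K\<close>.
The first entries on the other edges correspond to the non-initial vertices of \<open>G\<close>, where \<open>x \<notin> E\<close> iff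
\<open>\<alpha> x\<close> starts at a blue vertex. This counts the blue vertices, with one defect in total: either the
initial vertex is blue and is not counted, or it is not blue and then \<open>x0 \<notin> E\<close> is the first entry
that has to be left out (\<open>card_class_A_entries\<close>).\<close>

section \<open>Undirected walks in multigraphs\<close>

lemma cas_cong_ends:
  assumes "tail H' = tail H" "head H' = head H"
  shows "pre_digraph.cas H' u p v \<longleftrightarrow> pre_digraph.cas H u p v"
  by (induction p arbitrary: u) (simp_all add: pre_digraph.cas.simps assms)

lemma cas_iterates:
  assumes "\<And>j. head K (w j) = tail K (w (Suc j))"
  shows "pre_digraph.cas K (tail K (w i)) (map w [i..<i + k]) (tail K (w (i + k)))"
proof (induction k arbitrary: i)
  case (Suc k)
  have "[i..<i + Suc k] = i # [Suc i..<Suc i + k]" by (simp add: upt_conv_Cons)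
  then show ?case using Suc[of "Suc i"] assms[of i] by (simp add: pre_digraph.cas.simps)
qed (simp add: pre_digraph.cas.simps)

lemma two_way_simps [simp]:
  "verts (two_way H) = verts H" "arcs (two_way H) = arcs H \<times> UNIV"
  "tail (two_way H) (e, True) = tail H e" "tail (two_way H) (e, False) = head H e"
  "head (two_way H) (e, True) = head H e" "head (two_way H) (e, False) = tail H e"
  by (simp_all add: two_way_def)

lemma two_way_restrict_ends [simp]:
  "tail (two_way (H\<lparr>arcs := B\<rparr>)) = tail (two_way H)"
  "head (two_way (H\<lparr>arcs := B\<rparr>)) = head (two_way H)"
  by (auto simp: two_way_def)

lemma wf_digraph_two_way: "wf_digraph H \<Longrightarrow> wf_digraph (two_way H)"
  unfolding wf_digraph_def two_way_def by auto

lemma arcs_ends_two_way: "arcs_ends (two_way H) = (arcs_ends H)\<^sup>s"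
proof -
  have "UNIV = {True, False}" by auto
  then have "arcs H \<times> UNIV = (\<lambda>e. (e, True)) ` arcs H \<union> (\<lambda>e. (e, False)) ` arcs H" by auto
  then show ?thesis by (simp add: arcs_ends_conv symcl_def image_Un image_image)
qed

lemma connected_iff_reachable_two_way:
  "Digraph_Component.connected H \<longleftrightarrow> verts H \<noteq> {} \<and>
     (\<forall>u\<in>verts H. \<forall>w\<in>verts H. u \<rightarrow>\<^sup>*\<^bsub>two_way H\<^esub> w)"
  by (simp add: connected_conv reachable_def arcs_ends_two_way)

lemma reachable_two_way_sym:
  assumes "wf_digraph H" "u \<rightarrow>\<^sup>*\<^bsub>two_way H\<^esub> w"
  shows "w \<rightarrow>\<^sup>*\<^bsub>two_way H\<^esub> u"
proof -
  interpret wf_digraph "two_way H" by (rule wf_digraph_two_way) fact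
  have "symmetric (two_way H)"
    by (auto simp: symmetric_def arcs_ends_two_way symcl_def sym_def)
  then show ?thesis using assms(2) by (simp add: symmetric_reachable)
qed

lemma arc_reachable_two_way:
  assumes "wf_digraph H" "a \<in> arcs H"
  shows "tail H a \<rightarrow>\<^sup>*\<^bsub>two_way H\<^esub> head H a"
proof -
  interpret wf_digraph "two_way H" by (rule wf_digraph_two_way) fact
  have "(a, True) \<in> arcs (two_way H)" using assms by simp
  from arc_implies_awalk[OF this] show ?thesis by (auto simp: reachable_awalk)
qed

text \<open>The arc set \<open>B\<close> is a parameter so that a walk avoiding some arc can be moved to the subgraph without
that arc; this is how \<open>forest_arc_is_bridge\<close> gets applied to paths.\<close>

lemma awalk_reachable_two_way:
  assumes wf: "wf_digraph H" and p: "pre_digraph.awalk H u p w" and B: "set p \<subseteq> B"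
  shows "u \<rightarrow>\<^sup>*\<^bsub>two_way (H\<lparr>arcs := B\<rparr>)\<^esub> w"
proof -
  let ?K = "H\<lparr>arcs := arcs H \<inter> B\<rparr>"
  interpret H: wf_digraph H by (rule wf)
  have wfK: "wf_digraph ?K" using wf unfolding wf_digraph_def by auto
  interpret K: wf_digraph "two_way ?K" by (rule wf_digraph_two_way[OF wfK])
  have "u \<rightarrow>\<^sup>*\<^bsub>two_way ?K\<^esub> w" using p B
  proof (induction p arbitrary: u)
    case Nil
    then show ?case using K.reachable_refl[of u] by (auto simp: H.awalk_Nil_iff)
  next
    case (Cons a p)
    then have a: "a \<in> arcs ?K" "u = tail H a" and "head H a \<rightarrow>\<^sup>*\<^bsub>two_way ?K\<^esub> w"
      by (auto simp: H.awalk_Cons_iff)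
    then show ?case using arc_reachable_two_way[OF wfK a(1)] K.reachable_trans[of u "head H a" w]
      by simp
  qed
  moreover have "arcs_ends (two_way ?K) \<subseteq> arcs_ends (two_way (H\<lparr>arcs := B\<rparr>))"
    by (auto simp: arcs_ends_two_way arcs_ends_conv symcl_def)
  ultimately show ?thesis
    unfolding reachable_def by (elim rtrancl_on_mono[rotated -1]) auto
qed

text \<open>A path cannot use an edge in both directions: the second use would return to the vertex from which
the first one departed.\<close>

lemma apath_two_way_distinct_edges:
  assumes "wf_digraph H" "pre_digraph.apath (two_way H) u p w"
  shows "distinct (map fst p)"
proof -
  interpret W: wf_digraph "two_way H" by (rule wf_digraph_two_way) fact
  show ?thesis using assms(2)
  proof (induction p arbitrary: u)
    case (Cons e p)
    obtain a b where e: "e = (a, b)" by force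
    let ?m = "head (two_way H) e"
    from Cons.prems have p: "W.apath ?m p w" and u: "u \<notin> set (W.awalk_verts ?m p)"
      and ue: "u = tail (two_way H) e"
      by (auto simp: W.apath_Cons_iff)
    have "fst f \<noteq> a" if "f \<in> set p" for f
    proof
      assume "fst f = a"
      then have "tail (two_way H) f = u \<or> head (two_way H) f = u"
        using ue e by (cases f; cases b; cases "snd f") auto
      then show False
        using u W.awalk_verts_arc1[OF that] W.awalk_verts_arc2[OF _ that] p
        by (auto simp: W.apath_def)
    qed
    with Cons.IH[OF p] e show ?case by auto
  qed simp
qed

lemma undirected_forest_mono:
  assumes "undirected_forest H" "B \<subseteq> arcs H"
  shows "undirected_forest (H\<lparr>arcs := B\<rparr>)"
proof -
  let ?K = "two_way (H\<lparr>arcs := B\<rparr>)"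
  have "pre_digraph.cas ?K u p w = pre_digraph.cas (two_way H) u p w" for u p w
    by (rule cas_cong_ends) simp_all
  moreover have "pre_digraph.awalk_verts ?K u p = pre_digraph.awalk_verts (two_way H) u p" for u p
    by (simp add: pre_digraph.awalk_verts_conv)
  ultimately have "pre_digraph.cycle (two_way H) p" if "pre_digraph.cycle ?K p" for p
    using that assms(2) unfolding pre_digraph.cycle_def pre_digraph.awalk_def
    by (simp add: subset_iff) blast
  then show ?thesis using assms(1) unfolding undirected_forest_def by blast
qed

text \<open>A path between the ends of \<open>a\<close> that avoids \<open>a\<close> would close up with \<open>a\<close> to a cycle.\<close>

lemma forest_arc_is_bridge:
  assumes wf: "wf_digraph H" and forest: "undirected_forest H" and a: "a \<in> arcs H"
  shows "\<not> head H a \<rightarrow>\<^sup>*\<^bsub>two_way (H\<lparr>arcs := arcs H - {a}\<rparr>)\<^esub> tail H a"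
proof
  let ?K = "H\<lparr>arcs := arcs H - {a}\<rparr>"
  have wfK: "wf_digraph ?K" using wf unfolding wf_digraph_def by auto
  interpret K: wf_digraph "two_way ?K" by (rule wf_digraph_two_way[OF wfK])
  interpret W: wf_digraph "two_way H" by (rule wf_digraph_two_way[OF wf])
  assume "head H a \<rightarrow>\<^sup>*\<^bsub>two_way ?K\<^esub> tail H a"
  then obtain p where p: "K.apath (head H a) p (tail H a)"
    by (auto simp: K.reachable_apath)
  have "distinct (map fst p)" using apath_two_way_distinct_edges[OF wfK p] .
  moreover have "a \<notin> fst ` set p"
    using p by (auto simp: K.apath_def K.awalk_def)
  moreover have "W.cycle ((a, True) # p)"
  proof -
    have "W.cas (head H a) p (tail H a)"
      using p cas_cong_ends[of "two_way ?K" "two_way H"]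
      by (auto simp: K.apath_def K.awalk_def)
    moreover have "W.awalk_verts (head H a) p = K.awalk_verts (head H a) p"
      by (simp add: pre_digraph.awalk_verts_conv)
    ultimately show ?thesis
      using p a wf_digraph.tail_in_verts[OF wf a]
      by (auto simp: W.cycle_def W.awalk_def K.apath_def K.awalk_def intro!: exI[of _ "tail H a"])
  qed
  ultimately show False
    using forest unfolding undirected_forest_def by (auto dest!: spec[of _ "(a, True) # p"])
qed

section \<open>Trees ranked by a growth order\<close>

lemma closed_walk_heads_eq_tails:
  assumes "pre_digraph.cas K u p u" "p \<noteq> []"
  shows "head K ` set p = tail K ` set p"
proof -
  have "insert u (head K ` set p) = insert w (tail K ` set p) \<and> u \<in> tail K ` set p \<and> w \<in> head K ` set p"
    if "pre_digraph.cas K u p w" "p \<noteq> []" for u w p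
    using that
  proof (induction p arbitrary: u)
    case (Cons e p)
    then show ?case by (cases p) (fastforce simp: pre_digraph.cas.simps)+
  qed simp
  from this[OF assms] show ?thesis by (metis insert_absorb)
qed

text \<open>A tree certificate that does not depend on the orientation of the arcs: every vertex other than the root
is the child end of exactly one arc, and its parent end has smaller rank. All trees below arise from an
exploration, with the time of the first visit as rank. For arborescences the child end is always the
head, whereas the arcs of a spanning tree of the dual may point either way.\<close>

locale ranked_tree = wf_digraph H for H :: "('v, 'e) pre_digraph" (structure) +
  fixes r :: 'v and par ch :: "'e \<Rightarrow> 'v" and rank :: "'v \<Rightarrow> nat"
  assumes root: "r \<in> verts H"
    and ends: "a \<in> arcs H \<Longrightarrow> par a = tail H a \<and> ch a = head H a \<or> par a = head H a \<and> ch a = tail H a"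
    and ch_bij: "bij_betw ch (arcs H) (verts H - {r})"
    and rank: "a \<in> arcs H \<Longrightarrow> rank (par a) < rank (ch a)"
begin

lemma ch_eqD: "\<lbrakk>a \<in> arcs H; b \<in> arcs H; ch a = ch b\<rbrakk> \<Longrightarrow> a = b"
  using ch_bij by (auto simp: bij_betw_def inj_on_def)

lemma ch_in: "a \<in> arcs H \<Longrightarrow> ch a \<in> verts H - {r}"
  using ch_bij by (auto simp: bij_betw_def)

lemma ch_ex: "u \<in> verts H \<Longrightarrow> u \<noteq> r \<Longrightarrow> \<exists>a\<in>arcs H. ch a = u"
  using ch_bij by (auto simp: bij_betw_def image_iff) (metis Diff_iff image_iff singletonD)

lemma par_in: "a \<in> arcs H \<Longrightarrow> par a \<in> verts H"
  using ends by fastforce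

lemma root_reaches: 
  assumes "u \<in> verts H"
  shows "r \<rightarrow>\<^sup>*\<^bsub>two_way H\<^esub> u"
  using assms
proof (induction "rank u" arbitrary: u rule: less_induct)
  case less
  interpret W: wf_digraph "two_way H" by (rule wf_digraph_two_way) (rule wf_digraph_axioms)
  show ?case
  proof (cases "u = r")
    case False
    then obtain a where a: "a \<in> arcs H" "ch a = u" using ch_ex less.prems by blast
    then have "r \<rightarrow>\<^sup>*\<^bsub>two_way H\<^esub> par a" using less.hyps[of "par a"] rank par_in by blast
    moreover have "par a \<rightarrow>\<^sup>*\<^bsub>two_way H\<^esub> u"
      using arc_reachable_two_way[OF wf_digraph_axioms a(1)] ends[OF a(1)] a(2)
        reachable_two_way_sym[OF wf_digraph_axioms] by metis
    ultimately show ?thesis by (rule W.reachable_trans)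
  qed (use less.prems in \<open>simp add: W.reachable_refl\<close>)
qed

lemma connected: "Digraph_Component.connected H"
proof -
  interpret W: wf_digraph "two_way H" by (rule wf_digraph_two_way) (rule wf_digraph_axioms)
  show ?thesis
    using root root_reaches reachable_two_way_sym[OF wf_digraph_axioms] W.reachable_trans
    unfolding connected_iff_reachable_two_way by blast
qed

text \<open>At a vertex of maximal rank on a cycle, the two edges of the cycle would both have this vertex as child end
and therefore coincide.\<close>

lemma forest: "undirected_forest H"
  unfolding undirected_forest_def
proof (intro notI, elim exE conjE)
  fix p assume cyc: "pre_digraph.cycle (two_way H) p" and dist: "distinct (map fst p)"
  let ?t = "tail (two_way H)" and ?h = "head (two_way H)"
  from cyc obtain u where pA: "set p \<subseteq> arcs H \<times> UNIV" and cas: "pre_digraph.cas (two_way H) u p u"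
    and ne: "p \<noteq> []"
    unfolding pre_digraph.cycle_def pre_digraph.awalk_def by auto
  have ht: "?h ` set p = ?t ` set p" by (rule closed_walk_heads_eq_tails[OF cas ne])
  \<comment> \<open>the heads along a closed walk are also its tails, so \<open>m\<close> bounds the ranks at both ends\<close>
  define m where "m = Max (rank ` ?h ` set p)"
  have le: "rank (?h f) \<le> m" "rank (?t f) \<le> m" if "f \<in> set p" for f
  proof -
    show "rank (?h f) \<le> m" unfolding m_def using that by (intro Max_ge) auto
    have "?t f \<in> ?h ` set p" using that ht by auto
    then show "rank (?t f) \<le> m" unfolding m_def by (intro Max_ge) auto
  qed
  have "m \<in> rank ` ?h ` set p" unfolding m_def using ne by (intro Max_in) auto
  then obtain f where f: "f \<in> set p" "rank (?h f) = m" by auto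
  have "?h f \<in> ?t ` set p" using f(1) ht by auto
  then obtain g where g: "g \<in> set p" "?t g = ?h f" by auto
  have fA: "fst f \<in> arcs H" and gA: "fst g \<in> arcs H" using f(1) g(1) pA by auto
  have ef: "?h f = ch (fst f) \<and> ?t f = par (fst f) \<or> ?h f = par (fst f) \<and> ?t f = ch (fst f)"
    using ends[OF fA] by (cases f; cases "snd f") auto
  have eg: "?t g = ch (fst g) \<and> ?h g = par (fst g) \<or> ?t g = par (fst g) \<and> ?h g = ch (fst g)"
    using ends[OF gA] by (cases g; cases "snd g") auto
  have 1: "?h f = ch (fst f)" "?t f = par (fst f)" using ef rank[OF fA] le[OF f(1)] f(2) by auto
  have 2: "?t g = ch (fst g)" using eg rank[OF gA] le[OF g(1)] f(2) g(2) by auto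
  have "fst f = fst g" using ch_eqD[OF fA gA] 1(1) 2 g(2) by simp
  then have "f = g" using dist f(1) g(1) by (auto simp: distinct_map inj_on_def)
  then show False using g(2) 1 rank[OF fA] by simp
qed

lemma awalk_root_unique:
  assumes "par = tail H" "ch = head H"
  shows "\<lbrakk>awalk r p u; awalk r q u\<rbrakk> \<Longrightarrow> p = q"
proof (induction p arbitrary: u q rule: rev_induct)
  case Nil
  then show ?case using ch_in assms by (cases q rule: rev_cases) (auto simp: awalk_Cons_iff awalk_Nil_iff)
next
  case (snoc e p)
  then have e: "e \<in> arcs H" "head H e = u" "awalk r p (tail H e)"
    by (auto simp: awalk_Cons_iff awalk_Nil_iff)
  with snoc.prems(2) ch_in assms obtain f q' where q: "q = q' @ [f]"
    by (cases q rule: rev_cases) (auto simp: awalk_Nil_iff)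
  with snoc.prems(2) have f: "f \<in> arcs H" "head H f = u" "awalk r q' (tail H f)"
    by (auto simp: awalk_Cons_iff awalk_Nil_iff)
  have "e = f" using ch_eqD e f assms by auto
  then show ?case using snoc.IH e(3) f(3) q by simp
qed

lemma ex1_apath_from_root:
  assumes eq: "par = tail H" "ch = head H" and u: "u \<in> verts H"
  shows "\<exists>!p. apath r p u"
proof -
  have "r \<rightarrow>\<^sup>* u" using u
  proof (induction "rank u" arbitrary: u rule: less_induct)
    case less
    show ?case
    proof (cases "u = r")
      case False
      then obtain a where a: "a \<in> arcs H" "head H a = u" using ch_ex less.prems eq by blast
      then have "r \<rightarrow>\<^sup>* tail H a" using less.hyps[of "tail H a"] rank eq by auto
      then show ?thesis using a by (metis arc_implies_awalk reachable_awalk reachable_trans)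
    qed (use root in simp)
  qed
  then obtain p where "apath r p u" by (auto simp: reachable_apath)
  then show ?thesis using awalk_root_unique[OF eq] by (auto simp: apath_def)
qed

text \<open>Reversing the arcs whose child end is the head makes every arc point to its parent end, so the only way out of
a vertex leads along the ranks down to the root.\<close>

lemma away_orientation:
  defines "R \<equiv> {a \<in> arcs H. ch a = head H a}"
  assumes u: "u \<in> verts H"
  shows "\<exists>!p. pre_digraph.apath (reverse_arcs R H) u p r"
proof -
  let ?K = "reverse_arcs R H"
  have K: "verts ?K = verts H" "arcs ?K = arcs H" by (simp_all add: reverse_arcs_def)
  have tK: "tail ?K a = ch a" and hK: "head ?K a = par a" if "a \<in> arcs H" for a
    using ends[OF that] that by (auto simp: reverse_arcs_def R_def)
  interpret K: wf_digraph ?K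
    by standard (use tK hK ch_in par_in in \<open>auto simp: K\<close>)
  have unique: "p = q" if "K.awalk u p r" "K.awalk u q r" for p q u
    using that
  proof (induction p arbitrary: u q)
    case Nil
    then show ?case using ch_in tK by (cases q) (auto simp: K.awalk_Nil_iff K.awalk_Cons_iff K)
  next
    case (Cons e p)
    then have e: "e \<in> arcs H" "ch e = u" "K.awalk (par e) p r"
      using tK hK by (auto simp: K.awalk_Cons_iff K)
    with Cons.prems(2) ch_in obtain f q' where q: "q = f # q'"
      by (cases q) (auto simp: K.awalk_Nil_iff)
    with Cons.prems(2) have f: "f \<in> arcs H" "ch f = u" "K.awalk (par f) q' r"
      using tK hK by (auto simp: K.awalk_Cons_iff K)
    have "e = f" using ch_eqD e f by auto
    then show ?case using Cons.IH e(3) f(3) q by simp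
  qed
  have "u \<rightarrow>\<^sup>*\<^bsub>?K\<^esub> r" using u
  proof (induction "rank u" arbitrary: u rule: less_induct)
    case less
    show ?case
    proof (cases "u = r")
      case False
      then obtain a where a: "a \<in> arcs H" "ch a = u" using ch_ex less.prems by blast
      then have "par a \<rightarrow>\<^sup>*\<^bsub>?K\<^esub> r" using less.hyps[of "par a"] rank par_in by auto
      then show ?thesis using a tK hK K
        by (metis K.arc_implies_awalk K.reachable_awalk K.reachable_trans)
    qed (use root K in simp)
  qed
  then obtain p where "K.apath u p r" by (auto simp: K.reachable_apath)
  then show ?thesis using unique by (auto simp: K.apath_def)
qed

text \<open>Suppose that some arcs point away from the root after reversing \<open>R'\<close>, and take one whose child end has
maximal rank. A path from there to the root must leave by another arc. This arc joins the
vertex to one of its children, so it points away from the root too and has a child end of larger rank.\<close>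

lemma away_orientation_unique:
  assumes fin: "finite (arcs H)" and R': "R' \<subseteq> arcs H"
    and paths: "\<And>u. u \<in> verts H \<Longrightarrow> \<exists>p. pre_digraph.apath (reverse_arcs R' H) u p r"
  shows "R' = {a \<in> arcs H. ch a = head H a}"
proof -
  let ?K = "reverse_arcs R' H"
  \<comment> \<open>the arcs that still point away from the root\<close>
  define X where "X = {a \<in> arcs H. head ?K a = ch a}"
  have par_ch: "par a \<noteq> ch a" if "a \<in> arcs H" for a using rank[OF that] by auto
  have ht: "head ?K a = ch a \<and> tail ?K a = par a \<or> head ?K a = par a \<and> tail ?K a = ch a" if "a \<in> arcs H" for a
    using ends[OF that] by (auto simp: reverse_arcs_def)
  have "X = {}"
  proof (rule ccontr)
    assume "X \<noteq> {}"
    moreover have "finite X" using fin by (simp add: X_def)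
    ultimately have "Max (rank ` ch ` X) \<in> rank ` ch ` X" by (intro Max_in) auto
    then obtain a where a: "a \<in> X" and amax: "rank (ch a) = Max (rank ` ch ` X)" by auto
    have max: "rank (ch b) \<le> rank (ch a)" if "b \<in> X" for b
      unfolding amax using that \<open>finite X\<close> by (intro Max_ge) auto
    have aA: "a \<in> arcs H" using a by (simp add: X_def)
    obtain p where p: "pre_digraph.apath ?K (ch a) p r" using paths ch_in[OF aA] by blast
    have "p \<noteq> []" using p ch_in[OF aA]
      by (auto simp: pre_digraph.apath_def pre_digraph.awalk_def pre_digraph.cas.simps)
    then obtain b where b: "b \<in> arcs H" "tail ?K b = ch a"
      using p by (cases p)
        (auto simp: pre_digraph.apath_def pre_digraph.awalk_def pre_digraph.cas.simps reverse_arcs_def)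
    have "b \<noteq> a" using b a ht[OF aA] par_ch[OF aA] by (auto simp: X_def)
    then have "ch b \<noteq> ch a" using ch_eqD aA b(1) by blast
    then have "par b = ch a" "head ?K b = ch b" using ht[OF b(1)] b(2) by auto
    then have "b \<in> X" "rank (ch a) < rank (ch b)" using b(1) rank[OF b(1)] by (auto simp: X_def)
    then show False using max by force
  qed
  then show ?thesis
    using R' ends par_ch by (fastforce simp: X_def reverse_arcs_def split: if_splits)
qed

end

lemma E_away_ranked_tree:
  assumes "ranked_tree (H\<lparr>arcs := T\<rparr>) r par ch rank" and "finite T"
  shows "E_away H r T = {a \<in> T. ch a = head H a}"
proof -
  interpret ranked_tree "H\<lparr>arcs := T\<rparr>" r par ch rank by fact
  show ?thesis unfolding E_away_def
  proof (rule the_equality)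
    show "{a \<in> T. ch a = head H a} \<subseteq> T \<and>
      (\<forall>u\<in>verts H. \<exists>!p. pre_digraph.apath (reverse_arcs {a \<in> T. ch a = head H a} (H\<lparr>arcs := T\<rparr>)) u p r)"
      using away_orientation by auto
  next
    fix R assume R: "R \<subseteq> T \<and> (\<forall>u\<in>verts H. \<exists>!p. pre_digraph.apath (reverse_arcs R (H\<lparr>arcs := T\<rparr>)) u p r)"
    have "\<exists>p. pre_digraph.apath (reverse_arcs R (H\<lparr>arcs := T\<rparr>)) u p r" if "u \<in> verts H" for u
      using R that by (auto dest: ex1_implies_ex)
    then show "R = {a \<in> T. ch a = head H a}"
      using away_orientation_unique[of R] R assms(2) by simp
  qed
qed

section \<open>Arborescences\<close>

locale arborescence =
  fixes H :: "('v, 'e) pre_digraph" and v :: 'v and A :: "'e set"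
  assumes wf: "wf_digraph H" and root: "v \<in> verts H" and arb: "A \<in> arborescences H v"
begin

abbreviation "HA \<equiv> H\<lparr>arcs := A\<rparr>"

lemma A_arcs: "A \<subseteq> arcs H" using arb by (simp add: arborescences_def spanning_trees_def)

lemma wfA: "wf_digraph HA" using wf A_arcs unfolding wf_digraph_def by auto

sublocale A: wf_digraph HA by (rule wfA)

lemma apath_ex: "u \<in> verts H \<Longrightarrow> \<exists>p. A.apath v p u"
  using arb A.apath_Nil_iff[of v v] root by (cases "u = v") (auto simp: arborescences_def)

text \<open>Otherwise both ends of \<open>a\<close> would be linked to the root without using \<open>a\<close>, although \<open>a\<close> is a bridge. As a
path can only use \<open>a\<close> in its last step, this forces all paths into a vertex to end with the same arc.\<close>

lemma path_to_head_uses: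
  assumes a: "a \<in> A" and p: "A.apath v p (head H a)"
  shows "a \<in> set p"
proof (rule ccontr)
  assume nin: "a \<notin> set p"
  let ?K = "two_way (HA\<lparr>arcs := A - {a}\<rparr>)"
  have wfK: "wf_digraph (HA\<lparr>arcs := A - {a}\<rparr>)" using wfA unfolding wf_digraph_def by auto
  interpret K: wf_digraph ?K by (rule wf_digraph_two_way[OF wfK])
  have sub: "set p \<subseteq> A - {a}" using p nin by (auto simp: A.apath_def A.awalk_def)
  have hd: "v \<rightarrow>\<^sup>*\<^bsub>?K\<^esub> head H a"
    using p sub by (intro awalk_reachable_two_way wfA) (auto simp: A.apath_def)
  obtain q where q: "A.apath v q (tail H a)"
    using apath_ex a A_arcs wf by (meson subsetD wf_digraph.tail_in_verts)
  have "a \<notin> set q"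
  proof
    assume "a \<in> set q"
    then obtain q1 q2 where "q = q1 @ a # q2" by (auto simp: in_set_conv_decomp)
    then have "A.apath (tail H a) (a # q2) (tail H a)"
      using q A.apath_append_iff[of v q1 "a # q2"] A.apath_Cons_iff[of _ a q2] by auto
    then show False using A.apath_nonempty_ends by blast
  qed
  then have "set q \<subseteq> A - {a}" using q by (auto simp: A.apath_def A.awalk_def)
  then have "v \<rightarrow>\<^sup>*\<^bsub>?K\<^esub> tail H a"
    using q by (intro awalk_reachable_two_way wfA) (auto simp: A.apath_def)
  then have "head H a \<rightarrow>\<^sup>*\<^bsub>?K\<^esub> tail H a"
    using hd reachable_two_way_sym[OF wfK] K.reachable_trans by blast
  moreover have "undirected_forest HA"
    using arb by (simp add: arborescences_def spanning_trees_def)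
  ultimately show False using forest_arc_is_bridge[OF wfA, of a] a by simp
qed

lemma no_arc_into_root: "a \<in> A \<Longrightarrow> head H a \<noteq> v"
  using path_to_head_uses[of a "[]"] A.apath_Nil_iff[of v v] root by auto

lemma head_inj: 
  assumes "a \<in> A" "b \<in> A" "head H a = head H b"
  shows "a = b"
proof -
  have "head H a \<in> verts H" using assms A_arcs wf by (meson subsetD wf_digraph.head_in_verts)
  then obtain p where p: "A.apath v p (head H a)" using apath_ex by blast
  have last: "last p = c" if c: "c \<in> A" "head H c = head H a" for c
  proof -
    have "c \<in> set p" using path_to_head_uses c p by simp
    then obtain p1 p2 where p12: "p = p1 @ c # p2" by (auto simp: in_set_conv_decomp)
    then have "A.apath (head H c) p2 (head H c)"
      using p c A.apath_append_iff[of v p1 "c # p2"] A.apath_Cons_iff[of _ c p2] by auto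
    then have "p2 = []" using A.apath_nonempty_ends by blast
    then show ?thesis using p12 by simp
  qed
  show ?thesis using last assms by metis
qed

lemma arc_into:
  assumes "u \<in> verts H" "u \<noteq> v"
  shows "\<exists>a\<in>A. head H a = u"
proof -
  obtain p where "A.awalk v p u" using apath_ex assms by (auto simp: A.apath_def)
  then show ?thesis using assms(2)
    by (cases p rule: rev_cases) (auto simp: A.awalk_Nil_iff A.awalk_Cons_iff)
qed

text \<open>Induction along the paths from the root.\<close>

lemma root_induct [consumes 1, case_names root arc]:
  assumes "u \<in> verts H" and "P v" and step: "\<And>a. \<lbrakk>a \<in> A; P (tail H a)\<rbrakk> \<Longrightarrow> P (head H a)"
  shows "P u"
proof -
  obtain p where "A.awalk v p u" using apath_ex assms(1) by (auto simp: A.apath_def)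
  moreover have "P u" if "A.awalk w p u" "P w" for w p
    using that by (induction p arbitrary: w) (auto simp: A.awalk_Nil_iff A.awalk_Cons_iff step)
  ultimately show ?thesis using assms(2) by blast
qed

end

section \<open>Plane maps whose dual is an alternating dimap\<close>

locale alternating_plane_map =
  fixes G :: "'a cmap" and E :: "'a set"
  assumes plane: "plane_map G" and alternating: "alternating_dimap (dual_map G) E"
begin

abbreviation "S \<equiv> darts G"
abbreviation "\<sigma> \<equiv> rot G"
abbreviation "\<alpha> \<equiv> opp G"
abbreviation "\<phi> \<equiv> face_perm G"
abbreviation "D \<equiv> map_digraph (dual_map G) E"

lemma fin: "finite S" and rot_permutes: "\<sigma> permutes S" and opp_permutes: "\<alpha> permutes S"
  using plane by (auto simp: plane_map_def wf_cmap_def)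

lemma opp_opp [simp]: "\<alpha> (\<alpha> x) = x"
  using plane opp_permutes
  by (cases "x \<in> S") (auto simp: plane_map_def wf_cmap_def permutes_not_in)

lemma opp_neq: "x \<in> S \<Longrightarrow> \<alpha> x \<noteq> x"
  using plane by (auto simp: plane_map_def wf_cmap_def)

lemma opp_in [simp]: "\<alpha> x \<in> S \<longleftrightarrow> x \<in> S" and rot_in [simp]: "\<sigma> x \<in> S \<longleftrightarrow> x \<in> S"
  and inv_rot_in [simp]: "inv \<sigma> x \<in> S \<longleftrightarrow> x \<in> S"
  by (simp_all add: permutes_in_image opp_permutes rot_permutes permutes_inv)

lemma rot_inv [simp]: "\<sigma> (inv \<sigma> x) = x" and inv_rot [simp]: "inv \<sigma> (\<sigma> x) = x"
  using rot_permutes by (simp_all add: permutes_inverses)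

lemma opp_eq_iff [simp]: "\<alpha> x = \<alpha> y \<longleftrightarrow> x = y" by (metis opp_opp)
lemma rot_eq_iff [simp]: "\<sigma> x = \<sigma> y \<longleftrightarrow> x = y" by (metis inv_rot)
lemma inv_rot_eq_iff [simp]: "inv \<sigma> x = inv \<sigma> y \<longleftrightarrow> x = y" by (metis rot_inv)

lemma phi_permutes: "\<phi> permutes S"
proof -
  have "\<phi> = inv \<sigma> \<circ> \<alpha>" by (auto simp: face_perm_def)
  then show ?thesis using permutes_compose[OF opp_permutes permutes_inv[OF rot_permutes]] by simp
qed

lemma perms: "permutation \<sigma>" "permutation \<phi>"
  using fin rot_permutes phi_permutes by (auto simp: permutation_permutes)

lemma E_darts: "E \<subseteq> S"
  using alternating by (auto simp: alternating_dimap_def dual_map_def)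

lemma alternation: "\<forall>x\<in>S. x \<in> E \<longleftrightarrow> \<alpha> x \<notin> E" "\<forall>x\<in>S. x \<in> E \<longleftrightarrow> \<phi> x \<notin> E"
  using alternating unfolding alternating_dimap_def dual_map_def by (simp_all only: cmap.simps) blast+

lemma opp_in_E: "x \<in> S \<Longrightarrow> \<alpha> x \<in> E \<longleftrightarrow> x \<notin> E"
  using alternation(1) by blast

lemma rot_in_E [simp]: "\<sigma> x \<in> E \<longleftrightarrow> x \<in> E"
proof (cases "x \<in> S")
  case True
  then have "\<alpha> (\<sigma> x) \<in> S" by simp
  then have "\<phi> (\<alpha> (\<sigma> x)) \<in> E \<longleftrightarrow> \<alpha> (\<sigma> x) \<notin> E" using alternation(2) by blast
  then show ?thesis using opp_in_E[of "\<sigma> x"] True by (simp add: face_perm_def)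
next
  case False
  then show ?thesis using rot_permutes by (simp add: permutes_not_in)
qed

lemma in_vertex [simp]: "x \<in> vertex G x" and in_face [simp]: "x \<in> face G x"
  by (simp_all add: vertex_def face_def permutation_self_in_orbit perms)

lemma vertex_rot [simp]: "vertex G (\<sigma> x) = vertex G x"
  by (simp add: vertex_def permutation_orbit_step perms)

lemma vertex_inv_rot [simp]: "vertex G (inv \<sigma> x) = vertex G x"
  using vertex_rot[of "inv \<sigma> x"] by simp

lemma face_phi [simp]: "face G (\<phi> x) = face G x"
  by (simp add: face_def permutation_orbit_step perms)

lemma face_inv_rot: "face G (inv \<sigma> x) = face G (\<alpha> x)"
  using face_phi[of "\<alpha> x"] by (simp add: face_perm_def)

text \<open>The rotation preserves \<open>E\<close>, which is therefore a union of vertices.\<close>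

lemma vertex_in_E: "x \<in> S \<Longrightarrow> vertex G x \<subseteq> E \<longleftrightarrow> x \<in> E"
proof -
  have "y \<in> E \<longleftrightarrow> x \<in> E" if "y \<in> vertex G x" for y
    using that unfolding vertex_def by induction simp_all
  then show ?thesis using in_vertex by blast
qed

text \<open>As a dart of the dual, \<open>x\<close> runs from the face on its left to the face on its right.\<close>

lemma verts_D: "verts D = faces G" and arcs_D: "arcs D = E"
  and tail_D: "tail D = face G" and head_D: "head D e = face G (\<alpha> e)"
  by (simp_all add: map_digraph_def vertices_def faces_def dual_map_def vertex_def[abs_def] face_def[abs_def])

lemma wf_D: "wf_digraph (D\<lparr>arcs := T\<rparr>)" if "T \<subseteq> E" for T
  using that E_darts
  by unfold_locales (auto simp: verts_D tail_D head_D faces_def)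

text \<open>A dart \<open>x\<close> stands for the tour entering the crossing on the edge of \<open>x\<close> from the side of the vertex of \<open>x\<close>,
through the corner between \<open>x\<close> and \<open>\<sigma> x\<close>. If the edge is crossed by \<open>T\<close>, the tour stays at this vertex;
otherwise it changes to the other end of the edge and remains in the face on the left of \<open>x\<close>.\<close>

definition contour_step :: "'a set \<Rightarrow> 'a \<Rightarrow> 'a" where
  "contour_step T x = (if x \<in> T \<or> \<alpha> x \<in> T then inv \<sigma> x else \<phi> x)"

lemma contour_step_permutes:
  assumes "T \<subseteq> E"
  shows "contour_step T permutes S"
proof -
  have "bij (contour_step T)" unfolding bij_def
  proof
    show "inj (contour_step T)"
    proof (rule injI)
      fix x y assume "contour_step T x = contour_step T y"
      then show "x = y" by (auto simp: contour_step_def face_perm_def split: if_splits)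
    qed
    have "\<exists>x. contour_step T x = y" for y
      by (rule exI[of _ "if \<sigma> y \<in> T \<or> \<alpha> (\<sigma> y) \<in> T then \<sigma> y else \<alpha> (\<sigma> y)"])
        (auto simp: contour_step_def face_perm_def)
    then show "surj (contour_step T)" by (metis surjI)
  qed
  moreover have "contour_step T x = x" if "x \<notin> S" for x
    using that rot_permutes opp_permutes permutes_inv[OF rot_permutes]
    by (simp add: contour_step_def face_perm_def permutes_not_in)
  ultimately show ?thesis by (simp add: permutes_def bij_iff)
qed

lemma rot_contour_step: "\<sigma> (contour_step T x) = (if x \<in> T \<or> \<alpha> x \<in> T then x else \<alpha> x)"
  by (simp add: contour_step_def face_perm_def)

lemma contour_step_in [simp]: "T \<subseteq> E \<Longrightarrow> contour_step T x \<in> S \<longleftrightarrow> x \<in> S"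
  by (rule permutes_in_image) (rule contour_step_permutes)

section \<open>The contour of a spanning tree is a single cycle\<close>

lemma face_linked_step:
  assumes T: "T \<subseteq> E" and x: "x \<in> S"
  shows "face G x \<rightarrow>\<^sup>*\<^bsub>two_way (D\<lparr>arcs := T\<rparr>)\<^esub> face G (contour_step T x)"
proof -
  interpret W: wf_digraph "two_way (D\<lparr>arcs := T\<rparr>)" by (rule wf_digraph_two_way[OF wf_D[OF T]])
  have "face G y \<rightarrow>\<^sup>*\<^bsub>two_way (D\<lparr>arcs := T\<rparr>)\<^esub> face G (\<alpha> y)" if "y \<in> T" for y
    using arc_reachable_two_way[OF wf_D[OF T], of y] that by (simp add: tail_D head_D)
  from this[of x] this[of "\<alpha> x", THEN reachable_two_way_sym[OF wf_D[OF T]]]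
  show ?thesis using x by (auto simp: contour_step_def face_inv_rot verts_D faces_def)
qed

text \<open>Induction on \<open>T\<close>: a set \<open>Z\<close> that is a union of contour cycles is a union of components. When \<open>e\<close> is
added, the two contour permutations differ only by exchanging the images of \<open>e\<close> and \<open>\<alpha> e\<close>. If \<open>Z\<close>
contained just one of these, call it \<open>a\<close>, consider the darts \<open>C\<close> in the old component of \<open>a\<close>. The old
contour permutes \<open>C\<close> and agrees there with the new one except at \<open>a\<close>, which it sends out of \<open>Z\<close>. So it would map
\<open>C \<inter> Z - {a}\<close> onto \<open>C \<inter> Z\<close>, which is impossible for a finite set. Hence \<open>Z\<close> contains both darts
or none, is also invariant for the old contour, and the induction hypothesis applies.\<close>

lemma contour_invariant_respects_components:
  assumes "T \<subseteq> E" "undirected_forest (D\<lparr>arcs := T\<rparr>)"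
    and "\<And>x. x \<in> S \<Longrightarrow> contour_step T x \<in> Z \<longleftrightarrow> x \<in> Z"
    and "x \<in> S" "y \<in> S" "face G x \<rightarrow>\<^sup>*\<^bsub>two_way (D\<lparr>arcs := T\<rparr>)\<^esub> face G y"
  shows "x \<in> Z \<longleftrightarrow> y \<in> Z"
proof -
  have "finite T" using assms(1) E_darts fin by (meson finite_subset)
  then show ?thesis using assms
  proof (induction T arbitrary: x y)
    case empty
    have "(face G x, face G y) \<in> rtrancl_on (verts D) {}"
      using empty.prems(6) by (simp add: reachable_def arcs_ends_two_way arcs_ends_conv symcl_def)
    then have "face G x = face G y" by (cases rule: rtrancl_on.cases) auto
    then have "y \<in> orbit \<phi> x" using in_face[of y] by (simp add: face_def)
    then have "y \<in> S \<and> (x \<in> Z \<longleftrightarrow> y \<in> Z)"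
    proof induction
      case base
      then show ?case using empty.prems(3)[of x] empty.prems(4) phi_permutes
        by (simp add: contour_step_def permutes_in_image)
    next
      case (step y)
      then show ?case using empty.prems(3)[of y] phi_permutes
        by (simp add: contour_step_def permutes_in_image)
    qed
    then show ?case by simp
  next
    case (insert e T)
    let ?f = "contour_step T" and ?g = "contour_step (insert e T)"
    let ?K = "two_way (D\<lparr>arcs := T\<rparr>)"
    have TE: "T \<subseteq> E" and eE: "e \<in> E" using insert.prems by auto
    have eS: "e \<in> S" using eE E_darts by auto
    have oT: "\<alpha> e \<notin> T" using TE eE eS opp_in_E by auto
    have wfT: "wf_digraph (D\<lparr>arcs := T\<rparr>)" by (rule wf_D[OF TE])
    interpret K: wf_digraph ?K by (rule wf_digraph_two_way[OF wfT])
    have forT: "undirected_forest (D\<lparr>arcs := T\<rparr>)"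
      using undirected_forest_mono[OF insert.prems(2), of T] by auto
    have sep: "\<not> face G (\<alpha> e) \<rightarrow>\<^sup>*\<^bsub>?K\<^esub> face G e"
      using forest_arc_is_bridge[OF wf_D[OF insert.prems(1)] insert.prems(2), of e] insert.hyps(2)
      by (simp add: tail_D head_D)
    have g_e: "?g e = ?f (\<alpha> e)" and g_oe: "?g (\<alpha> e) = ?f e"
      using insert.hyps(2) oT by (auto simp: contour_step_def face_perm_def)
    have g_other: "?g z = ?f z" if "z \<noteq> e" "z \<noteq> \<alpha> e" for z
      using that by (auto simp: contour_step_def)
    \<comment> \<open>the set \<open>Z\<close> cannot separate the two darts of the new edge\<close>
    have not_split: False
      if ab: "a = e \<and> b = \<alpha> e \<or> a = \<alpha> e \<and> b = e" and aO: "a \<in> Z" and bO: "b \<notin> Z" for a b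
    proof -
      define C where "C = {z \<in> S. face G a \<rightarrow>\<^sup>*\<^bsub>?K\<^esub> face G z}"
      have aS: "a \<in> S" and bS: "b \<in> S" using ab eS by auto
      have aC: "a \<in> C" using aS by (simp add: C_def verts_D faces_def)
      have bC: "b \<notin> C" using sep ab reachable_two_way_sym[OF wfT] by (auto simp: C_def)
      have finC: "finite C" using fin by (simp add: C_def)
      have "?f ` C \<subseteq> C"
        using face_linked_step[OF TE] TE by (auto simp: C_def intro: K.reachable_trans)
      moreover have injf: "inj_on ?f C"
        using permutes_inj[OF contour_step_permutes[OF TE]] by (auto intro: inj_on_subset)
      ultimately have fC: "?f ` C = C" using finC by (metis endo_inj_surj)
      have "?f a = ?g b" using ab g_e g_oe by auto
      then have fa: "?f a \<notin> Z" using insert.prems(3)[OF bS] bO by simp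
      have "?f ` (C \<inter> Z - {a}) = C \<inter> Z"
      proof
        show "?f ` (C \<inter> Z - {a}) \<subseteq> C \<inter> Z"
        proof
          fix w assume "w \<in> ?f ` (C \<inter> Z - {a})"
          then obtain z where z: "z \<in> C" "z \<in> Z" "z \<noteq> a" "w = ?f z" by auto
          have "z \<noteq> b" using z(1) bC by auto
          then have "?g z = ?f z" using ab z(3) by (intro g_other) auto
          then show "w \<in> C \<inter> Z" using z insert.prems(3)[of z] fC by (auto simp: C_def)
        qed
        show "C \<inter> Z \<subseteq> ?f ` (C \<inter> Z - {a})"
        proof
          fix w assume w: "w \<in> C \<inter> Z"
          then obtain z where z: "z \<in> C" "w = ?f z" using fC by blast
          have "z \<noteq> a" using fa w z by auto
          moreover have "z \<noteq> b" using z(1) bC by auto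
          ultimately have "?g z = ?f z" using ab by (intro g_other) auto
          then have "z \<in> Z" using w z insert.prems(3)[of z] by (auto simp: C_def)
          then show "w \<in> ?f ` (C \<inter> Z - {a})" using z \<open>z \<noteq> a\<close> by auto
        qed
      qed
      then have "card (C \<inter> Z) \<le> card (C \<inter> Z - {a})"
        using finC by (metis card_image_le finite_Diff finite_Int)
      moreover have "card (C \<inter> Z - {a}) < card (C \<inter> Z)"
        using finC aC aO by (intro card_Diff1_less) auto
      ultimately show False by simp
    qed
    have e_oe: "e \<in> Z \<longleftrightarrow> \<alpha> e \<in> Z" using not_split[of e "\<alpha> e"] not_split[of "\<alpha> e" e] by auto
    have f_inv: "?f z \<in> Z \<longleftrightarrow> z \<in> Z" if "z \<in> S" for z
      using insert.prems(3)[OF that] insert.prems(3)[of e] insert.prems(3)[of "\<alpha> e"]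
        g_e g_oe g_other[of z] e_oe eS by (cases "z = e \<or> z = \<alpha> e") auto
    have IH: "z \<in> Z \<longleftrightarrow> w \<in> Z" if "z \<in> S" "w \<in> S" "face G z \<rightarrow>\<^sup>*\<^bsub>?K\<^esub> face G w" for z w
      using insert.IH[OF TE forT f_inv] that by blast
    have same: "z \<in> Z \<longleftrightarrow> w \<in> Z" if "z \<in> S" "w \<in> S" "face G z = face G w" for z w
      using IH[OF that(1,2)] that by (simp add: verts_D faces_def)
    have arc: "c \<in> Z \<longleftrightarrow> \<alpha> c \<in> Z" if c: "c \<in> insert e T" for c
    proof (cases "c = e")
      case False
      then have "face G c \<rightarrow>\<^sup>*\<^bsub>?K\<^esub> face G (\<alpha> c)"
        using c arc_reachable_two_way[OF wfT, of c] by (simp add: tail_D head_D)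
      then show ?thesis using IH[of c "\<alpha> c"] c False TE E_darts by auto
    qed (use e_oe in simp)
    have "\<forall>z\<in>S. face G z = F \<longrightarrow> (x \<in> Z \<longleftrightarrow> z \<in> Z)"
      if "(face G x, F) \<in> rtrancl_on (verts D) (arcs_ends (two_way (D\<lparr>arcs := insert e T\<rparr>)))" for F
      using that
    proof (induction rule: rtrancl_on_induct)
      case base
      show ?case using same[OF insert.prems(4)] by metis
    next
      case (step F F')
      have "(F, F') \<in> (arcs_ends (D\<lparr>arcs := insert e T\<rparr>))\<^sup>s"
        using step.hyps(2) by (simp only: arcs_ends_two_way)
      then obtain c where c: "c \<in> insert e T"
        and FF: "F = face G c \<and> F' = face G (\<alpha> c) \<or> F = face G (\<alpha> c) \<and> F' = face G c"
        by (auto simp: arcs_ends_conv symcl_def tail_D head_D)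
      have cS: "c \<in> S" "\<alpha> c \<in> S" using c TE eE E_darts by auto
      have "x \<in> Z \<longleftrightarrow> c \<in> Z" using FF arc[OF c] step.IH cS by blast
      then show ?case using FF arc[OF c] same cS by blast
    qed
    from this[of "face G y"] show ?case
      using insert.prems(5,6) by (simp add: reachable_def)
  qed
qed

text \<open>The contour cycle of \<open>x\<close> is an invariant set, and the tree has only one component.\<close>

lemma spanning_tree_contour_cyclic:
  assumes T: "T \<in> spanning_trees D" and x: "x \<in> S"
  shows "orbit (contour_step T) x = S"
proof -
  have TE: "T \<subseteq> E" and conn: "Digraph_Component.connected (D\<lparr>arcs := T\<rparr>)"
    and forest: "undirected_forest (D\<lparr>arcs := T\<rparr>)"
    using T by (auto simp: spanning_trees_def arcs_D)
  let ?O = "orbit (contour_step T) x"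
  have perm: "permutation (contour_step T)"
    using contour_step_permutes[OF TE] fin by (auto simp: permutation_permutes)
  have inv: "contour_step T y \<in> ?O \<longleftrightarrow> y \<in> ?O" for y
    using permutation_orbit_step[OF perm] permutation_self_in_orbit[OF perm]
    by (metis orbit.step orbit_trans orbit_swap)
  have "y \<in> ?O" if "y \<in> S" for y
  proof -
    have "face G x \<rightarrow>\<^sup>*\<^bsub>two_way (D\<lparr>arcs := T\<rparr>)\<^esub> face G y"
      using conn x that by (simp add: connected_iff_reachable_two_way verts_D faces_def)
    then show ?thesis
      using contour_invariant_respects_components[OF TE forest inv x that]
        permutation_self_in_orbit[OF perm] by blast
  qed
  moreover have "?O \<subseteq> S"
    using permutes_orbit_subset[OF contour_step_permutes[OF TE] x] .
  ultimately show ?thesis by blast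
qed

end

section \<open>first_darts passages along a contour\<close>

text \<open>A counting principle that exploits equality in Euler's formula: a surjection onto a set that is as large
as the source leaves no room for collisions or for additional elements.\<close>

lemma bij_betw_tight:
  assumes "finite X" "W \<subseteq> X" "B \<subseteq> g ` W" "card X \<le> card B"
  shows "W = X \<and> bij_betw g X B"
proof -
  have fW: "finite W" using assms finite_subset by blast
  have B: "finite B" "card B \<le> card (g ` W)"
    using assms(3) fW by (auto intro: finite_subset card_mono)
  have 1: "card (g ` W) \<le> card W" using fW by (rule card_image_le)
  have 2: "card W \<le> card X" using assms by (intro card_mono)
  have "W = X" using card_subset_eq[OF assms(1,2)] 1 2 B(2) assms(4) by simp
  moreover have "card (g ` W) = card W" using 1 2 B(2) assms(4) by simp
  then have "inj_on g W" using fW by (intro eq_card_imp_inj_on)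
  moreover have "g ` W = B" using card_subset_eq[of "g ` W" B] fW assms(3,4) B(2) 1 2 by simp
  ultimately show ?thesis by (simp add: bij_betw_def)
qed

text \<open>The tour built from an arborescence is known to be a single contour before it is known to belong to a
spanning tree; for this reason the cycle, and not the tree, is the starting point here.\<close>

locale contour_tour = alternating_plane_map G E for G :: "'a cmap" and E +
  fixes T :: "'a set" and x0 :: 'a
  assumes T_E: "T \<subseteq> E" and x0_in: "x0 \<in> S" and cyclic: "orbit (contour_step T) x0 = S"
begin

abbreviation "f \<equiv> contour_step T"
abbreviation "n \<equiv> card S"
abbreviation "visit i \<equiv> (f ^^ i) x0"

definition pos :: "'a \<Rightarrow> nat" where "pos = funpow_dist f x0"

text \<open>The darts by which the tour enters their edge for the first time.\<close>

definition first_darts :: "'a set" where "first_darts = {x \<in> S. pos x < pos (\<alpha> x)}"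

text \<open>The time of the first visit to the place labelled \<open>q\<close>; it is used for faces, for vertices and for crossings.\<close>

definition entry :: "('a \<Rightarrow> 'q) \<Rightarrow> 'q \<Rightarrow> nat" where
  "entry l q = (LEAST i. \<exists>x\<in>S. l x = q \<and> pos x = i)"

lemma visit_pos [simp]: "x \<in> S \<Longrightarrow> visit (pos x) = x"
  using cyclic by (simp add: pos_def funpow_dist_prop)

lemma visit_in [simp]: "visit i \<in> S"
  using x0_in T_E by (induction i) simp_all

lemma visits: "inj_on (\<lambda>i. visit i) {0..<n}" "(\<lambda>i. visit i) ` {0..<n} = S" "visit n = x0"
proof -
  let ?d = "funpow_dist1 f x0 x0"
  have self: "x0 \<in> orbit f x0" using cyclic x0_in by simp
  have inj: "inj_on (\<lambda>i. visit i) {0..<?d}" by (rule inj_on_funpow_dist1[OF self])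
  have img: "(\<lambda>i. visit i) ` {0..<?d} = S" using orbit_conv_funpow_dist1[OF self] cyclic by simp
  have "n = ?d" using card_image[OF inj] img by simp
  then show "inj_on (\<lambda>i. visit i) {0..<n}" "(\<lambda>i. visit i) ` {0..<n} = S" "visit n = x0"
    using inj img funpow_dist1_prop[OF self] by simp_all
qed

lemma pos_visit: "i < n \<Longrightarrow> pos (visit i) = i"
proof -
  assume i: "i < n"
  have "pos (visit i) \<le> i" unfolding pos_def funpow_dist_def by (rule Least_le) simp
  moreover have "visit (pos (visit i)) = visit i" by simp
  ultimately show ?thesis using i visits(1) by (auto simp: inj_on_def)
qed

lemma pos_less:
  assumes "x \<in> S"
  shows "pos x < n"
proof -
  have "x \<in> (\<lambda>i. visit i) ` {0..<n}" using assms visits(2) by simp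
  then obtain i where "i < n" "x = visit i" by auto
  then show ?thesis using pos_visit[of i] by simp
qed

lemma pos_inj:
  assumes "x \<in> S" "y \<in> S" "pos x = pos y"
  shows "x = y"
proof -
  have "x = visit (pos x)" using assms(1) by (rule visit_pos[symmetric])
  also have "\<dots> = visit (pos y)" by (simp only: assms(3))
  also have "\<dots> = y" using assms(2) by (rule visit_pos)
  finally show ?thesis .
qed

lemma pos_x0: "pos x0 = 0" by (simp add: pos_def funpow_dist_0)

lemma pos_step:
  assumes "x \<in> S" "f x \<noteq> x0"
  shows "pos (f x) = Suc (pos x)"
proof -
  have v: "visit (Suc (pos x)) = f x" using assms(1) by simp
  have "Suc (pos x) \<noteq> n" using v visits(3) assms(2) by metis
  then have "Suc (pos x) < n" using pos_less[OF assms(1)] by simp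
  from pos_visit[OF this] show ?thesis using v by simp
qed

lemma pred_ex:
  assumes "x \<in> S" "x \<noteq> x0"
  shows "\<exists>y\<in>S. f y = x \<and> pos x = Suc (pos y)"
proof -
  obtain y where y: "f y = x" using permutes_surj[OF contour_step_permutes[OF T_E]] by (metis surjD)
  then have "y \<in> S" using contour_step_in[OF T_E, of y] assms(1) by simp
  then show ?thesis using pos_step[of y] y assms(2) by auto
qed

lemma first_darts_alt: "x \<in> S \<Longrightarrow> \<alpha> x \<in> first_darts \<longleftrightarrow> x \<notin> first_darts"
  using pos_inj[of x "\<alpha> x"] opp_neq[of x]
  by (cases "pos x" "pos (\<alpha> x)" rule: linorder_cases) (auto simp: first_darts_def)

lemma x0_first: "x0 \<in> first_darts"
  using x0_in pos_x0 pos_inj[of x0 "\<alpha> x0"] opp_neq[of x0] by (auto simp: first_darts_def)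

lemma first_darts_subset: "first_darts \<subseteq> S" by (auto simp: first_darts_def)

lemma entry_le: "x \<in> S \<Longrightarrow> entry l (l x) \<le> pos x"
  unfolding entry_def by (rule Least_le) auto

lemma entry_attained: "q \<in> l ` S \<Longrightarrow> \<exists>x\<in>S. l x = q \<and> pos x = entry l q"
  unfolding entry_def by (rule LeastI_ex) auto

text \<open>The step by which the tour first reaches \<open>q\<close> crosses some \<open>x \<in> K\<close>. This is the first use of its edge,
since an earlier passage in the other direction would have started at \<open>q\<close>.\<close>

lemma first_passage:
  assumes K: "K \<subseteq> S" "\<And>x. x \<in> K \<Longrightarrow> l (f x) = l (\<alpha> x)" "\<And>x. x \<in> S - K \<Longrightarrow> l (f x) = l x"
    and q: "q \<in> l ` S" "q \<noteq> l x0"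
  shows "\<exists>x\<in>first_darts \<inter> K. l (\<alpha> x) = q \<and> entry l (l x) < entry l q"
proof -
  obtain y where y: "y \<in> S" "l y = q" "pos y = entry l q" using entry_attained[OF q(1)] by blast
  then obtain x where x: "x \<in> S" "f x = y" "pos y = Suc (pos x)" using pred_ex[of y] q(2) by blast
  have lt: "entry l (l x) < entry l q" using entry_le[OF x(1), of l] x(3) y(3) by simp
  then have "l x \<noteq> l y" using y(2) by auto
  then have xK: "x \<in> K" using K(3)[of x] x by auto
  then have ox: "l (\<alpha> x) = q" using K(2)[of x] x y by simp
  then have "pos x < pos (\<alpha> x)" using entry_le[of "\<alpha> x" l] x y(3) by simp
  then show ?thesis using xK ox lt x(1) by (auto simp: first_darts_def)
qed

abbreviation "toward e \<equiv> if e \<in> first_darts then e else \<alpha> e"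

text \<open>\<open>E\<close> and \<open>first_darts\<close> both contain exactly one dart of each edge.\<close>

lemma toward_bij_betw:
  assumes K: "K \<subseteq> S" "\<And>x. x \<in> K \<Longrightarrow> \<alpha> x \<in> K"
  shows "bij_betw (\<lambda>e. if e \<in> first_darts then e else \<alpha> e) (E \<inter> K) (first_darts \<inter> K)"
  unfolding bij_betw_def
proof
  show "inj_on (\<lambda>e. if e \<in> first_darts then e else \<alpha> e) (E \<inter> K)"
    using opp_in_E E_darts by (auto simp: inj_on_def)
  show "(\<lambda>e. if e \<in> first_darts then e else \<alpha> e) ` (E \<inter> K) = first_darts \<inter> K" (is "?r ` _ = _")
  proof
    show "?r ` (E \<inter> K) \<subseteq> first_darts \<inter> K" using K first_darts_alt by auto
    show "first_darts \<inter> K \<subseteq> ?r ` (E \<inter> K)"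
    proof
      fix x assume x: "x \<in> first_darts \<inter> K"
      show "x \<in> ?r ` (E \<inter> K)"
      proof (cases "x \<in> E")
        case True
        then show ?thesis using x by (intro image_eqI[of _ _ x]) auto
      next
        case False
        have xS: "x \<in> S" using x K(1) by auto
        then have "\<alpha> x \<in> E \<inter> K" using x K(2) opp_in_E False by auto
        moreover have "\<alpha> x \<notin> first_darts" using x xS first_darts_alt by auto
        ultimately show ?thesis by (intro image_eqI[of _ _ "\<alpha> x"]) simp_all
      qed
    qed
  qed
qed

abbreviation "tree_darts \<equiv> {x \<in> S. x \<in> T \<or> \<alpha> x \<in> T}"
abbreviation "cotree_darts \<equiv> {x \<in> S. x \<notin> T \<and> \<alpha> x \<notin> T}"

lemma E_tree_darts: "E \<inter> tree_darts = T" using T_E E_darts opp_in_E by auto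
lemma E_cotree_darts: "E \<inter> cotree_darts = E - T" using T_E E_darts opp_in_E by auto

lemma toward_bij: "bij_betw (\<lambda>e. toward e) T (first_darts \<inter> tree_darts)" "bij_betw (\<lambda>e. toward e) (E - T) (first_darts \<inter> cotree_darts)"
proof -
  have "bij_betw (\<lambda>e. toward e) (E \<inter> tree_darts) (first_darts \<inter> tree_darts)" by (rule toward_bij_betw) auto
  then show "bij_betw (\<lambda>e. toward e) T (first_darts \<inter> tree_darts)" by (simp only: E_tree_darts)
  have "bij_betw (\<lambda>e. toward e) (E \<inter> cotree_darts) (first_darts \<inter> cotree_darts)" by (rule toward_bij_betw) auto
  then show "bij_betw (\<lambda>e. toward e) (E - T) (first_darts \<inter> cotree_darts)" by (simp only: E_cotree_darts)
qed

lemma euler: "card (vertices G) + card (faces G) = card E + 2"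
proof -
  have "bij_betw (\<lambda>e. {e, \<alpha> e}) E (edges G)"
    unfolding bij_betw_def
  proof
    show "inj_on (\<lambda>e. {e, \<alpha> e}) E"
      using opp_in_E E_darts by (auto simp: inj_on_def doubleton_eq_iff)
    show "(\<lambda>e. {e, \<alpha> e}) ` E = edges G"
    proof
      show "edges G \<subseteq> (\<lambda>e. {e, \<alpha> e}) ` E"
      proof
        fix X assume "X \<in> edges G"
        then obtain x where x: "x \<in> S" "X = {x, \<alpha> x}" by (auto simp: edges_def)
        then have "x \<in> E \<or> \<alpha> x \<in> E" using opp_in_E by auto
        moreover have "X = {\<alpha> x, \<alpha> (\<alpha> x)}" using x by auto
        ultimately show "X \<in> (\<lambda>e. {e, \<alpha> e}) ` E" using x(2) by blast
      qed
    qed (use E_darts in \<open>auto simp: edges_def\<close>)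
  qed
  then have "card (edges G) = card E" by (metis bij_betw_same_card)
  then show ?thesis using plane by (simp add: plane_map_def)
qed

text \<open>The first entries in \<open>K\<close> that lead to a place discovered later; \<open>first_passage\<close> produces such darts, and
the count below shows that there are no other first entries in \<open>K\<close>.\<close>

definition forward :: "('a \<Rightarrow> 'q) \<Rightarrow> 'a set \<Rightarrow> 'a set" where
  "forward l K = {x \<in> first_darts \<inter> K. entry l (l x) < entry l (l (\<alpha> x))}"

text \<open>First passages give at least \<open>card (faces G) - 1\<close> edges in \<open>T\<close> and at least \<open>card (vertices G) - 1\<close> edges
outside \<open>T\<close>. By Euler's formula these bounds add up to the number of all edges, so both are attained. This
is the only place where the genus matters.\<close>

lemma passages_bij:
  "card (faces G) = Suc (card T)" "card (vertices G) = Suc (card (E - T))"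
  "forward (face G) tree_darts = first_darts \<inter> tree_darts" "bij_betw (\<lambda>x. face G (\<alpha> x)) (first_darts \<inter> tree_darts) (faces G - {face G x0})"
  "forward (vertex G) cotree_darts = first_darts \<inter> cotree_darts" "bij_betw (\<lambda>x. vertex G (\<alpha> x)) (first_darts \<inter> cotree_darts) (vertices G - {vertex G x0})"
proof -
  have f1: "faces G - {face G x0} \<subseteq> (\<lambda>x. face G (\<alpha> x)) ` forward (face G) tree_darts"
  proof
    fix q assume q: "q \<in> faces G - {face G x0}"
    have "\<exists>x\<in>first_darts \<inter> tree_darts. face G (\<alpha> x) = q \<and> entry (face G) (face G x) < entry (face G) q"
      using q by (intro first_passage) (auto simp: contour_step_def face_inv_rot faces_def)
    then show "q \<in> (\<lambda>x. face G (\<alpha> x)) ` forward (face G) tree_darts" by (auto simp: forward_def)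
  qed
  have v1: "vertices G - {vertex G x0} \<subseteq> (\<lambda>x. vertex G (\<alpha> x)) ` forward (vertex G) cotree_darts"
  proof
    fix q assume q: "q \<in> vertices G - {vertex G x0}"
    have "\<exists>x\<in>first_darts \<inter> cotree_darts. vertex G (\<alpha> x) = q \<and> entry (vertex G) (vertex G x) < entry (vertex G) q"
      using q by (intro first_passage) (auto simp: contour_step_def face_perm_def vertices_def)
    then show "q \<in> (\<lambda>x. vertex G (\<alpha> x)) ` forward (vertex G) cotree_darts" by (auto simp: forward_def)
  qed
  have finF: "finite first_darts" using first_darts_subset fin by (rule finite_subset)
  have sub: "forward (face G) tree_darts \<subseteq> first_darts \<inter> tree_darts" "forward (vertex G) cotree_darts \<subseteq> first_darts \<inter> cotree_darts"
    by (auto simp: forward_def)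
  have cT: "card (first_darts \<inter> tree_darts) = card T"
    using bij_betw_same_card[OF toward_bij(1)] by simp
  have cC: "card (first_darts \<inter> cotree_darts) = card (E - T)"
    using bij_betw_same_card[OF toward_bij(2)] by simp
  have finE: "finite E" using E_darts fin by (rule finite_subset)
  have cE: "card T + card (E - T) = card E"
    using T_E finE by (metis add_diff_inverse_nat card_Diff_subset card_mono finite_subset not_less)
  have rt: "face G x0 \<in> faces G" "vertex G x0 \<in> vertices G"
    using x0_in by (auto simp: faces_def vertices_def)
  have finV: "finite (faces G)" "finite (vertices G)"
    using fin by (auto simp: faces_def vertices_def)
  have cf: "card (faces G - {face G x0}) = card (faces G) - 1" 
    and cv: "card (vertices G - {vertex G x0}) = card (vertices G) - 1"
    using rt finV by simp_all
  have pos: "card (faces G) > 0" "card (vertices G) > 0" using rt finV by (auto simp: card_gt_0_iff)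
  have f2: "card (faces G - {face G x0}) \<le> card (first_darts \<inter> tree_darts)"
    using f1 sub(1) finF by (meson finite_Int finite_subset surj_card_le card_mono order_trans)
  have v2: "card (vertices G - {vertex G x0}) \<le> card (first_darts \<inter> cotree_darts)"
    using v1 sub(2) finF by (meson finite_Int finite_subset surj_card_le card_mono order_trans)
  show F: "card (faces G) = Suc (card T)" and V: "card (vertices G) = Suc (card (E - T))"
    using euler f2 v2 cf cv cT cC cE pos by linarith+
  show "forward (face G) tree_darts = first_darts \<inter> tree_darts" 
    "bij_betw (\<lambda>x. face G (\<alpha> x)) (first_darts \<inter> tree_darts) (faces G - {face G x0})"
    using bij_betw_tight[OF _ sub(1) f1] finF F cf cT by simp_all
  show "forward (vertex G) cotree_darts = first_darts \<inter> cotree_darts"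
    "bij_betw (\<lambda>x. vertex G (\<alpha> x)) (first_darts \<inter> cotree_darts) (vertices G - {vertex G x0})"
    using bij_betw_tight[OF _ sub(2) v1] finF V cv cC by simp_all
qed

lemma dual_ranked_tree:
  "ranked_tree (D\<lparr>arcs := T\<rparr>) (face G x0) (\<lambda>e. face G (toward e)) (\<lambda>e. face G (\<alpha> (toward e)))
     (entry (face G))"
proof -
  interpret W: wf_digraph "D\<lparr>arcs := T\<rparr>" by (rule wf_D[OF T_E])
  have TF: "toward e \<in> first_darts \<inter> tree_darts" if "e \<in> T" for e
    using that T_E E_darts first_darts_alt by auto
  show ?thesis
  proof
    show "face G x0 \<in> verts (D\<lparr>arcs := T\<rparr>)" using x0_in by (simp add: verts_D faces_def)
  next
    fix a
    show "face G (toward a) = tail (D\<lparr>arcs := T\<rparr>) a \<and> face G (\<alpha> (toward a)) = head (D\<lparr>arcs := T\<rparr>) a \<or>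
      face G (toward a) = head (D\<lparr>arcs := T\<rparr>) a \<and> face G (\<alpha> (toward a)) = tail (D\<lparr>arcs := T\<rparr>) a"
      by (simp add: tail_D head_D)
  next
    have "bij_betw ((\<lambda>x. face G (\<alpha> x)) \<circ> (\<lambda>e. toward e)) T (faces G - {face G x0})"
      by (rule bij_betw_trans[OF toward_bij(1) passages_bij(4)])
    then show "bij_betw (\<lambda>e. face G (\<alpha> (toward e))) (arcs (D\<lparr>arcs := T\<rparr>))
       (verts (D\<lparr>arcs := T\<rparr>) - {face G x0})"
      by (simp add: verts_D comp_def)
  next
    fix a assume "a \<in> arcs (D\<lparr>arcs := T\<rparr>)"
    then have "toward a \<in> forward (face G) tree_darts" using TF[of a] passages_bij(3) by simp
    then show "entry (face G) (face G (toward a)) < entry (face G) (face G (\<alpha> (toward a)))"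
      by (simp add: forward_def)
  qed
qed

lemma T_spanning: "T \<in> spanning_trees D"
  using ranked_tree.connected[OF dual_ranked_tree] ranked_tree.forest[OF dual_ranked_tree] T_E
  by (simp add: spanning_trees_def arcs_D)

text \<open>On an edge in \<open>T\<close> the first entry points from the parent face to the child face, so the arcs counted on
the left are those that run opposite to it.\<close>

lemma card_toward_root:
  "card (T - E_away D (face G x0) T) = card {x \<in> first_darts \<inter> tree_darts. x \<notin> E}"
proof -
  have finT: "finite T" using T_E E_darts fin by (meson finite_subset)
  have "face G (\<alpha> (toward e)) = head D e \<longleftrightarrow> e \<in> first_darts" if e: "e \<in> T" for e
  proof -
    have "face G (toward e) \<noteq> face G (\<alpha> (toward e))"
      using ranked_tree.rank[OF dual_ranked_tree, of e] e by auto
    then show ?thesis using e T_E E_darts by (auto simp: head_D split: if_splits)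
  qed
  then have "E_away D (face G x0) T = {e \<in> T. e \<in> first_darts}"
    unfolding E_away_ranked_tree[OF dual_ranked_tree finT] by (intro Collect_cong conj_cong refl)
  then have "T - E_away D (face G x0) T = T - first_darts" by auto
  moreover have "{x \<in> first_darts \<inter> tree_darts. x \<notin> E} = \<alpha> ` (T - first_darts)"
  proof
    show "{x \<in> first_darts \<inter> tree_darts. x \<notin> E} \<subseteq> \<alpha> ` (T - first_darts)"
    proof
      fix x assume x: "x \<in> {x \<in> first_darts \<inter> tree_darts. x \<notin> E}"
      then have "\<alpha> x \<in> T - first_darts" using T_E first_darts_alt by auto
      then show "x \<in> \<alpha> ` (T - first_darts)" by (metis imageI opp_opp)
    qed
    show "\<alpha> ` (T - first_darts) \<subseteq> {x \<in> first_darts \<inter> tree_darts. x \<notin> E}"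
      using T_E E_darts first_darts_alt opp_in_E by auto
  qed
  ultimately show ?thesis by (simp add: card_image inj_on_def)
qed

lemma card_cotree_entries:
  "card {x \<in> first_darts \<inter> cotree_darts. x \<notin> E} = card ({q \<in> vertices G. q \<subseteq> E} - {vertex G x0})"
proof -
  let ?g = "\<lambda>x. vertex G (\<alpha> x)"
  have "vertex G (\<alpha> x) \<subseteq> E \<longleftrightarrow> x \<notin> E" if "x \<in> first_darts \<inter> cotree_darts" for x
    using that vertex_in_E[of "\<alpha> x"] opp_in_E by auto
  then have eq: "{x \<in> first_darts \<inter> cotree_darts. x \<notin> E} = {x \<in> first_darts \<inter> cotree_darts. ?g x \<subseteq> E}"
    by (intro Collect_cong conj_cong refl) simp
  have "?g ` {x \<in> first_darts \<inter> cotree_darts. ?g x \<subseteq> E} = ?g ` (first_darts \<inter> cotree_darts) \<inter> {q. q \<subseteq> E}"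
    by blast
  also have "?g ` (first_darts \<inter> cotree_darts) = vertices G - {vertex G x0}"
    using passages_bij(6) by (rule bij_betw_imp_surj_on)
  also have "(vertices G - {vertex G x0}) \<inter> {q. q \<subseteq> E} = {q \<in> vertices G. q \<subseteq> E} - {vertex G x0}"
    by blast
  finally have img: "?g ` {x \<in> first_darts \<inter> cotree_darts. x \<notin> E} = {q \<in> vertices G. q \<subseteq> E} - {vertex G x0}"
    by (simp only: eq)
  have "inj_on ?g {x \<in> first_darts \<inter> cotree_darts. x \<notin> E}"
    using bij_betw_imp_inj_on[OF passages_bij(6)] by (rule inj_on_subset) blast
  from card_image[OF this] show ?thesis by (simp only: img)
qed

text \<open>The starting dart is discounted on the left, the starting vertex on the right; whether \<open>x0\<close> lies in \<open>E\<close>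
decides which of the two makes a difference, and never both do.\<close>

lemma card_class_A_entries:
  assumes "E \<noteq> {}"
  shows "card {x \<in> first_darts - {x0}. x \<notin> E} =
    card (T - E_away D (face G x0) T) + (card {q \<in> vertices G. q \<subseteq> E} - 1)"
proof -
  let ?B = "{q \<in> vertices G. q \<subseteq> E}"
  have finF: "finite first_darts" using first_darts_subset fin by (rule finite_subset)
  have finB: "finite ?B" using fin by (simp add: vertices_def)
  have "{x \<in> first_darts. x \<notin> E} = {x \<in> first_darts \<inter> tree_darts. x \<notin> E} \<union> {x \<in> first_darts \<inter> cotree_darts. x \<notin> E}"
    using first_darts_subset by auto
  moreover have "{x \<in> first_darts \<inter> tree_darts. x \<notin> E} \<inter> {x \<in> first_darts \<inter> cotree_darts. x \<notin> E} = {}" by auto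
  ultimately have all: "card {x \<in> first_darts. x \<notin> E} =
      card (T - E_away D (face G x0) T) + card (?B - {vertex G x0})"
    using card_toward_root card_cotree_entries finF by (simp add: card_Un_disjoint)
  obtain e where "e \<in> E" using assms by blast
  then have "vertex G e \<in> ?B" using vertex_in_E E_darts by (auto simp: vertices_def)
  then have posB: "card ?B > 0" using finB by (auto simp: card_gt_0_iff)
  show ?thesis
  proof (cases "x0 \<in> E")
    case True
    then have "vertex G x0 \<in> ?B" using vertex_in_E x0_in by (auto simp: vertices_def)
    then have "card (?B - {vertex G x0}) = card ?B - 1" using finB by simp
    moreover have "{x \<in> first_darts - {x0}. x \<notin> E} = {x \<in> first_darts. x \<notin> E}" using True by auto
    ultimately show ?thesis using all by simp
  next
    case False
    then have "?B - {vertex G x0} = ?B" using vertex_in_E x0_in by auto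
    moreover have "{x \<in> first_darts - {x0}. x \<notin> E} = {x \<in> first_darts. x \<notin> E} - {x0}" by auto
    then have "card {x \<in> first_darts - {x0}. x \<notin> E} = card {x \<in> first_darts. x \<notin> E} - 1"
      using False x0_first finF by simp
    ultimately show ?thesis using all posB by simp
  qed
qed

end

section \<open>Crowell's digraph in terms of darts\<close>

context alternating_plane_map
begin

abbreviation "M \<equiv> medial G"
abbreviation "H \<equiv> crowell_digraph G E"

text \<open>The arc that enters the crossing on the edge of \<open>x\<close> on the side of \<open>x\<close>. Indexing arcs by the dart at which they
arrive makes \<open>Phi\<close> an iteration of \<open>contour_step\<close>.\<close>

definition arc :: "'a \<Rightarrow> 'a \<times> side" where "arc x = (\<sigma> x, Rgt)"

lemma medial_simps [simp]:
  "darts M = S \<times> UNIV"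
  "x \<in> S \<Longrightarrow> rot M (x, Lft) = (x, Rgt)" "x \<in> S \<Longrightarrow> rot M (x, Rgt) = (\<alpha> x, Lft)"
  "x \<in> S \<Longrightarrow> opp M (x, Lft) = (\<sigma> x, Rgt)" "x \<in> S \<Longrightarrow> opp M (x, Rgt) = (inv \<sigma> x, Lft)"
  by (simp_all add: medial_def)

lemma inj_medial_rot: "inj (rot M)"
proof (rule injI)
  fix h k assume eq: "rot M h = rot M k"
  obtain x s y t where hk: "h = (x, s)" "k = (y, t)" by force
  show "h = k" using eq unfolding hk
    by (cases s; cases t) (auto simp: medial_def split: if_splits)
qed

lemma medial_face_perm:
  assumes "x \<in> S"
  shows "face_perm M (x, Lft) = (\<sigma> x, Lft)" "face_perm M (x, Rgt) = (\<alpha> (inv \<sigma> x), Rgt)"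
proof -
  have "opp M (x, Lft) = rot M (\<sigma> x, Lft)" using assms by simp
  then show "face_perm M (x, Lft) = (\<sigma> x, Lft)"
    by (simp only: face_perm_def inv_f_f[OF inj_medial_rot])
  have "opp M (x, Rgt) = rot M (\<alpha> (inv \<sigma> x), Rgt)" using assms by simp
  then show "face_perm M (x, Rgt) = (\<alpha> (inv \<sigma> x), Rgt)"
    by (simp only: face_perm_def inv_f_f[OF inj_medial_rot])
qed

lemma face_medial_Lft:
  assumes "x \<in> S"
  shows "face M (x, Lft) = G_region (vertex G x)"
proof -
  let ?h = "\<lambda>d. (d, Lft)"
  have "face_perm M (?h y) = ?h (\<sigma> y)" if "y \<in> orbit \<sigma> x" for y
  proof -
    have "y \<in> S" using that permutes_orbit_subset[OF rot_permutes assms] by (rule rev_subsetD)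
    then show ?thesis by (rule medial_face_perm)
  qed
  from orbit_inverse[where f = ?h and g' = "face_perm M", OF permutation_self_in_orbit[OF perms(1)] this]
  show ?thesis by (simp only: face_def G_region_def vertex_def)
qed

lemma face_medial_Rgt:
  assumes "x \<in> S"
  shows "face M (x, Rgt) = D_region G (face G (\<alpha> x))"
proof -
  let ?h = "\<lambda>d. (\<alpha> d, Rgt)"
  have "face_perm M (?h y) = ?h (\<phi> y)" if "y \<in> orbit \<phi> (\<alpha> x)" for y
  proof -
    have "\<alpha> x \<in> S" using assms by simp
    then have "y \<in> S" using that permutes_orbit_subset[OF phi_permutes] by blast
    then have "\<alpha> y \<in> S" by simp
    from medial_face_perm(2)[OF this] show ?thesis by (simp only: face_perm_def)
  qed
  from orbit_inverse[where f = ?h and g' = "face_perm M", OF permutation_self_in_orbit[OF perms(2)] this]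
  show ?thesis by (simp only: face_def D_region_def opp_opp)
qed

lemma G_region_eq_iff [simp]: "G_region u = G_region w \<longleftrightarrow> u = w"
  unfolding G_region_def by (rule inj_image_eq_iff) (simp add: inj_on_def)

lemma D_region_neq_G_region: "D_region G (face G x) \<noteq> G_region u"
proof
  assume eq: "D_region G (face G x) = G_region u"
  have "(\<alpha> x, Rgt) \<in> D_region G (face G x)" by (auto simp: D_region_def)
  then show False unfolding eq by (auto simp: G_region_def)
qed

lemma D_regions_eq: "D_regions G = (\<lambda>x. D_region G (face G x)) ` S"
  by (auto simp: D_regions_def vertices_def vertex_def face_def dual_map_def)

lemma G_regions_eq: "G_regions G = (\<lambda>x. G_region (vertex G x)) ` S"
  by (auto simp: G_regions_def vertices_def)

lemma vertex_medial:
  assumes "x \<in> S"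
  shows "vertex M (x, s) = {x, \<alpha> x} \<times> UNIV"
proof
  show "vertex M (x, s) \<subseteq> {x, \<alpha> x} \<times> UNIV"
  proof
    fix h assume "h \<in> vertex M (x, s)"
    then show "h \<in> {x, \<alpha> x} \<times> UNIV" unfolding vertex_def
    proof induction
      case base
      then show ?case using assms by (cases s) auto
    next
      case (step h)
      then obtain y t where "h = (y, t)" "y \<in> {x, \<alpha> x}" by auto
      then show ?case using assms by (cases t) auto
    qed
  qed
  let ?O = "orbit (rot M) (x, s)"
  have LR: "(y, Rgt) \<in> ?O" if "(y, Lft) \<in> ?O" "y \<in> S" for y
    using orbit.step[OF that(1)] that(2) by simp
  have RL: "(\<alpha> y, Lft) \<in> ?O" if "(y, Rgt) \<in> ?O" "y \<in> S" for y
    using orbit.step[OF that(1)] that(2) by simp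
  have b: "rot M (x, s) \<in> ?O" by (rule orbit.base)
  have "(\<alpha> x, Lft) \<in> ?O"
    using b assms RL[of x] by (cases s) auto
  with assms have 1: "(\<alpha> x, Rgt) \<in> ?O" using LR[of "\<alpha> x"] by simp
  then have 2: "(x, Lft) \<in> ?O" using RL[of "\<alpha> x"] assms by simp
  then have 3: "(x, Rgt) \<in> ?O" using LR[of x] assms by simp
  have "(y, t) \<in> ?O" if "y = x \<or> y = \<alpha> x" for y t
    using that 1 2 3 \<open>(\<alpha> x, Lft) \<in> ?O\<close> by (cases t) auto
  then show "{x, \<alpha> x} \<times> UNIV \<subseteq> vertex M (x, s)" by (auto simp: vertex_def)
qed

lemma crossing_eq: "x \<in> S \<Longrightarrow> crossing G x = {x, \<alpha> x} \<times> UNIV"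
  by (simp add: crossing_def vertex_medial)

lemma crossing_eq_iff: "\<lbrakk>x \<in> S; y \<in> S\<rbrakk> \<Longrightarrow> crossing G x = crossing G y \<longleftrightarrow> y = x \<or> y = \<alpha> x"
  unfolding crossing_eq by (auto simp: times_eq_iff doubleton_eq_iff)

lemma crossing_opp [simp]: "x \<in> S \<Longrightarrow> crossing G (\<alpha> x) = crossing G x"
  by (simp add: crossing_eq insert_commute)

lemma vertex_medial_crossing: "x \<in> S \<Longrightarrow> vertex M (x, s) = crossing G x"
  by (simp add: vertex_medial crossing_eq)

lemma link_out_Rgt:
  assumes x: "x \<in> S"
  shows "link_out G E (x, Rgt) \<longleftrightarrow> x \<in> E"
proof -
  have "face M (x, Rgt) \<notin> class_A G E"
    using D_region_neq_G_region by (auto simp: face_medial_Rgt x class_A_def)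
  moreover have "G_region (vertex G x) \<in> class_B G E \<longleftrightarrow> x \<in> E"
  proof
    assume "G_region (vertex G x) \<in> class_B G E"
    then obtain e where "e \<in> E" "vertex G x = vertex G e" by (auto simp: class_B_def)
    then show "x \<in> E" using vertex_in_E[of x] vertex_in_E[of e] x E_darts by auto
  qed (simp add: class_B_def)
  ultimately show ?thesis using x by (simp add: link_out_def face_medial_Lft)
qed

lemma link_out_Lft:
  assumes x: "x \<in> S"
  shows "link_out G E (x, Lft) \<longleftrightarrow> x \<notin> E"
proof -
  have "face M (\<sigma> x, Rgt) \<notin> class_B G E"
    using D_region_neq_G_region x by (auto simp: face_medial_Rgt class_B_def)
  moreover have "G_region (vertex G x) \<in> class_A G E \<longleftrightarrow> x \<notin> E"
  proof
    assume "G_region (vertex G x) \<in> class_A G E"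
    then obtain e where "e \<in> E" "vertex G x = vertex G (\<alpha> e)" by (auto simp: class_A_def)
    then show "x \<notin> E"
      using vertex_in_E[of x] vertex_in_E[of "\<alpha> e"] opp_in_E[of e] x E_darts by auto
  next
    assume "x \<notin> E"
    then have "\<alpha> x \<in> E" using opp_in_E x by simp
    then show "G_region (vertex G x) \<in> class_A G E"
      unfolding class_A_def by (intro image_eqI[of _ _ "\<alpha> x"]) simp_all
  qed
  ultimately show ?thesis using x by (simp add: link_out_def face_medial_Lft)
qed

text \<open>In the link, both half-edges on the left sides of \<open>x\<close> and \<open>\<alpha> x\<close> change their in/out status at the
counterclockwise successor, while those on the right sides keep it. So the over-strands are the right sides.\<close>

lemma over_iff: "x \<in> S \<Longrightarrow> over G E (x, s) \<longleftrightarrow> s = Rgt"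
  by (cases s) (simp_all add: over_def link_out_Lft link_out_Rgt opp_in_E)

lemma crowell_arcs_eq: "crowell_arcs G E = arc ` S"
proof -
  have "h \<in> crowell_arcs G E \<longleftrightarrow> h \<in> arc ` S" for h
  proof -
    obtain x s where h: "h = (x, s)" by force
    have "h \<in> arc ` S \<longleftrightarrow> x \<in> S \<and> s = Rgt"
    proof
      assume "x \<in> S \<and> s = Rgt"
      then show "h \<in> arc ` S" unfolding h by (intro image_eqI[of _ _ "inv \<sigma> x"]) (simp_all add: arc_def)
    qed (auto simp: arc_def h)
    moreover have "h \<in> crowell_arcs G E \<longleftrightarrow> x \<in> S \<and> s = Rgt"
      unfolding h crowell_arcs_def by (cases s) (auto simp: over_iff)
    ultimately show ?thesis by simp
  qed
  then show ?thesis by blast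
qed

lemma arc_eq_iff [simp]: "arc x = arc y \<longleftrightarrow> x = y" by (simp add: arc_def)

lemma opp_arc: "x \<in> S \<Longrightarrow> opp M (arc x) = (x, Lft)" by (simp add: arc_def)

lemma verts_H: "verts H = crossing G ` S"
proof -
  have "vertices M = (\<lambda>(x, s). crossing G x) ` (S \<times> (UNIV :: side set))"
    unfolding vertices_def medial_simps(1) by (rule image_cong) (auto simp: vertex_medial_crossing)
  also have "\<dots> = crossing G ` S" by force
  finally show ?thesis by (simp add: crowell_digraph_def map_digraph_def)
qed

lemma arcs_H: "arcs H = arc ` S"
  by (simp add: crowell_digraph_def map_digraph_def crowell_arcs_eq)

lemma tail_arc: "x \<in> S \<Longrightarrow> tail H (arc x) = crossing G (\<sigma> x)"
  by (simp add: crowell_digraph_def map_digraph_def arc_def vertex_medial_crossing)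

lemma head_arc: "x \<in> S \<Longrightarrow> head H (arc x) = crossing G x"
  by (simp add: crowell_digraph_def map_digraph_def opp_arc vertex_medial_crossing)

lemma wf_H: "B \<subseteq> arc ` S \<Longrightarrow> wf_digraph (H\<lparr>arcs := B\<rparr>)"
  by unfold_locales (auto simp: verts_H tail_arc head_arc)

lemma wf_crowell: "wf_digraph H"
  by unfold_locales (auto simp: verts_H arcs_H tail_arc head_arc)

lemma var_arc: "x \<in> S \<Longrightarrow> var G E (arc x) = (if x \<in> E then 1 else - t_var)"
  by (simp add: var_def left_of_over_def opp_arc over_iff link_out_Rgt)

lemma next_arc_contour_step:
  assumes T: "T \<subseteq> E" and x: "x \<in> S"
  shows "next_arc G E T (arc x) = arc (contour_step T x)"
proof -
  have cond: "(\<exists>e\<in>T. head H (arc x) = crossing G e) \<longleftrightarrow> x \<in> T \<or> \<alpha> x \<in> T"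
  proof -
    have "head H (arc x) = crossing G e \<longleftrightarrow> e = x \<or> e = \<alpha> x" if "e \<in> T" for e
      using that T E_darts x by (simp add: head_arc crossing_eq_iff subset_iff)
    then show ?thesis by blast
  qed
  have mem: "g \<in> crowell_arcs G E \<longleftrightarrow> (\<exists>y\<in>S. g = (y, Rgt))" for g
  proof
    assume "\<exists>y\<in>S. g = (y, Rgt)"
    then obtain y where "y \<in> S" "g = (y, Rgt)" by blast
    then show "g \<in> crowell_arcs G E"
      unfolding crowell_arcs_eq by (intro image_eqI[of _ _ "inv \<sigma> y"]) (simp_all add: arc_def)
  qed (auto simp: crowell_arcs_eq arc_def)
  have corner: "bound_corner M (x, Lft) (y, Rgt) R \<longleftrightarrow>
      y = x \<and> R = G_region (vertex G x) \<or> y = \<alpha> x \<and> R = D_region G (face G x)" if "y \<in> S" for y R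
  proof -
    have "\<alpha> y = x \<longleftrightarrow> y = \<alpha> x" by auto
    then show ?thesis
      using that x by (auto simp: bound_corner_def face_medial_Lft face_medial_Rgt)
  qed
  have GG: "G_region (vertex G x) \<in> G_regions G" and DD: "D_region G (face G x) \<in> D_regions G"
    using x by (simp_all add: G_regions_eq D_regions_eq)
  have DG: "D_region G (face G x) \<notin> G_regions G"
    using D_region_neq_G_region by (auto simp: G_regions_eq)
  have GD: "G_region (vertex G x) \<notin> D_regions G"
    using D_region_neq_G_region[symmetric] by (auto simp: D_regions_eq)
  have arc_step: "arc (contour_step T x) = (if x \<in> T \<or> \<alpha> x \<in> T then (x, Rgt) else (\<alpha> x, Rgt))"
    by (simp add: arc_def rot_contour_step)
  show ?thesis
    unfolding next_arc_def cond opp_arc[OF x] arc_step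
  proof (rule the_equality)
    show "(if x \<in> T \<or> \<alpha> x \<in> T then (x, Rgt) else (\<alpha> x, Rgt)) \<in> crowell_arcs G E \<and>
      (\<exists>R\<in>if x \<in> T \<or> \<alpha> x \<in> T then G_regions G else D_regions G.
        bound_corner M (x, Lft) (if x \<in> T \<or> \<alpha> x \<in> T then (x, Rgt) else (\<alpha> x, Rgt)) R)"
    proof (cases "x \<in> T \<or> \<alpha> x \<in> T")
      case True
      then show ?thesis using mem x GG corner[OF x, of "G_region (vertex G x)"] by auto
    next
      case False
      then show ?thesis using mem x DD corner[of "\<alpha> x" "D_region G (face G x)"] by auto
    qed
  next
    fix g
    assume g: "g \<in> crowell_arcs G E \<and> (\<exists>R\<in>if x \<in> T \<or> \<alpha> x \<in> T then G_regions G else D_regions G.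
        bound_corner M (x, Lft) g R)"
    then obtain y R where y: "y \<in> S" "g = (y, Rgt)"
      and R: "R \<in> (if x \<in> T \<or> \<alpha> x \<in> T then G_regions G else D_regions G)" "bound_corner M (x, Lft) (y, Rgt) R"
      using mem by auto
    show "g = (if x \<in> T \<or> \<alpha> x \<in> T then (x, Rgt) else (\<alpha> x, Rgt))"
      using R(1) corner[OF y(1), THEN iffD1, OF R(2)] GD DG y(2) by (auto split: if_splits)
  qed
qed

text \<open>The boundary of a \<open>G\<close>-region consists of the arcs of the darts at the vertex, which all have weight \<open>1\<close>
or all have weight \<open>- t\<close>.\<close>

lemma card_blue_regions: "card (blue_regions G E) = card {q \<in> vertices G. q \<subseteq> E}"
proof -
  have bd: "boundary_arcs G E (G_region (vertex G x)) = arc ` vertex G x" if x: "x \<in> S" for x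
  proof -
    have sub: "vertex G x \<subseteq> S"
      unfolding vertex_def using permutes_orbit_subset[OF rot_permutes x] .
    have "h \<in> boundary_arcs G E (G_region (vertex G x)) \<longleftrightarrow> h \<in> arc ` vertex G x" for h
    proof -
      have "arc y \<in> boundary_arcs G E (G_region (vertex G x)) \<longleftrightarrow> y \<in> vertex G x" if "y \<in> S" for y
        using that by (auto simp: boundary_arcs_def crowell_arcs_eq opp_arc G_region_def) (auto simp: arc_def)
      moreover have "h \<in> arc ` S" if "h \<in> boundary_arcs G E (G_region (vertex G x))"
        using that by (simp add: boundary_arcs_def crowell_arcs_eq)
      ultimately show ?thesis using sub by blast
    qed
    then show ?thesis by blast
  qed
  have neq: "- t_var \<noteq> 1" by (simp add: one_pCons)
  have "(\<forall>h\<in>boundary_arcs G E (G_region q). var G E h = 1) \<longleftrightarrow> q \<subseteq> E" if q: "q \<in> vertices G" for q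
  proof -
    obtain x where x: "x \<in> S" "q = vertex G x" using q by (auto simp: vertices_def)
    have "q \<subseteq> S" unfolding x(2) vertex_def using permutes_orbit_subset[OF rot_permutes x(1)] .
    then have "var G E (arc y) = 1 \<longleftrightarrow> y \<in> E" if "y \<in> q" for y
      using that neq by (simp add: var_arc subset_iff)
    then show ?thesis using bd[OF x(1)] x(2) by auto
  qed
  then have "blue_regions G E = G_region ` {q \<in> vertices G. q \<subseteq> E}"
    unfolding blue_regions_def G_regions_def by blast
  then show ?thesis by (simp add: card_image inj_on_def)
qed

end

section \<open>The Eulerian tour of a contour and its first entries\<close>

lemma hd_filter_nth:
  assumes "i < length xs" "P (xs ! i)" "\<And>j. j < i \<Longrightarrow> \<not> P (xs ! j)"
  shows "hd (filter P xs) = xs ! i"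
proof -
  have "xs = take i xs @ xs ! i # drop (Suc i) xs" using assms(1) by (rule id_take_nth_drop)
  moreover have "filter P (take i xs) = []"
    using assms(1,3) by (auto simp: filter_empty_conv in_set_conv_nth)
  ultimately have "filter P xs = xs ! i # filter P (drop (Suc i) xs)"
    using assms(2) by (metis append_Nil filter.simps(2) filter_append)
  then show ?thesis by simp
qed

context contour_tour
begin

lemma Phi_eq: "Phi G E (arc x0) T = map (\<lambda>i. arc (visit i)) [0..<n]"
proof -
  have "(next_arc G E T ^^ i) (arc x0) = arc (visit i)" for i
    by (induction i) (simp_all add: next_arc_contour_step[OF T_E])
  moreover have "card (crowell_arcs G E) = n"
    unfolding crowell_arcs_eq by (rule card_image) (simp add: inj_on_def)
  ultimately show ?thesis by (simp add: Phi_def)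
qed

lemma tail_arc_step: "x \<in> S \<Longrightarrow> tail H (arc (f x)) = crossing G x"
  using T_E by (simp add: tail_arc rot_contour_step)

lemma Phi_euler: "Phi G E (arc x0) T \<in> euler_tours_from H (arc x0)"
proof -
  let ?C = "map (\<lambda>i. arc (visit i)) [0..<n]"
  let ?u = "crossing G (\<sigma> x0)"
  interpret H: wf_digraph H by (rule wf_crowell)
  have n: "n > 0" using fin x0_in by (auto simp: card_gt_0_iff)
  have set_C: "set ?C = arcs H"
  proof -
    have "set ?C = arc ` (\<lambda>i. visit i) ` {0..<n}" by (simp add: image_image)
    then show ?thesis by (simp only: visits(2) arcs_H)
  qed
  have "H.cas (tail H (arc (visit 0))) (map (\<lambda>i. arc (visit i)) [0..<0 + n]) (tail H (arc (visit (0 + n))))"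
    by (rule cas_iterates) (simp add: head_arc tail_arc_step)
  then have cas: "H.cas ?u ?C ?u" using visits(3) x0_in by (simp add: tail_arc)
  have dist: "distinct ?C"
    using visits(1) by (auto simp: distinct_map inj_on_def)
  have "?u \<in> verts H" using x0_in by (simp add: verts_H)
  then have aw: "H.awalk ?u ?C ?u" using set_C cas by (simp add: H.awalk_def)
  have "set (H.awalk_verts ?u ?C) = verts H"
  proof
    show "set (H.awalk_verts ?u ?C) \<subseteq> verts H" using aw by (elim H.awalkE')
    have "crossing G x \<in> set (H.awalk_verts ?u ?C)" if "x \<in> S" for x
    proof -
      have "arc x \<in> set ?C" using that set_C arcs_H by blast
      from H.awalk_verts_arc2[OF aw this] show ?thesis using head_arc[OF that] by simp
    qed
    then show "verts H \<subseteq> set (H.awalk_verts ?u ?C)" unfolding verts_H by blast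
  qed
  then have "H.euler_trail ?u ?C ?u"
    using aw dist set_C by (simp add: H.euler_trail_def H.trail_def)
  moreover have "?C \<noteq> []" "hd ?C = arc x0" using n by (simp_all add: hd_map)
  ultimately show ?thesis unfolding Phi_eq euler_tours_from_def by blast
qed

lemma crossings_of_first_darts: "verts H - {crossing G x0} = crossing G ` (first_darts - {x0})"
proof
  show "verts H - {crossing G x0} \<subseteq> crossing G ` (first_darts - {x0})"
  proof
    fix u assume u: "u \<in> verts H - {crossing G x0}"
    then obtain x where x: "x \<in> S" "u = crossing G x" by (auto simp: verts_H)
    then have "x \<noteq> x0" "\<alpha> x \<noteq> x0" "u = crossing G (\<alpha> x)" using u by auto
    then show "u \<in> crossing G ` (first_darts - {x0})" using x first_darts_alt[OF x(1)] by blast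
  qed
  show "crossing G ` (first_darts - {x0}) \<subseteq> verts H - {crossing G x0}"
  proof
    fix u assume "u \<in> crossing G ` (first_darts - {x0})"
    then obtain x where x: "x \<in> first_darts" "x \<noteq> x0" "u = crossing G x" by blast
    have xS: "x \<in> S" using x(1) first_darts_subset by blast
    have "x0 \<noteq> \<alpha> x" using first_darts_alt[OF xS] x(1) x0_first by auto
    then have "u \<noteq> crossing G x0" using x xS x0_in by (simp add: crossing_eq_iff)
    then show "u \<in> verts H - {crossing G x0}" using x xS by (simp add: verts_H)
  qed
qed

lemma Psi_Phi: "Psi H (crossing G x0) (Phi G E (arc x0) T) = arc ` (first_darts - {x0})"
proof -
  let ?C = "map (\<lambda>i. arc (visit i)) [0..<n]"
  have first: "hd (filter (\<lambda>e. head H e = crossing G x) ?C) = arc x" if x: "x \<in> first_darts" for x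
  proof -
    have xS: "x \<in> S" using x first_darts_subset by blast
    have "hd (filter (\<lambda>e. head H e = crossing G x) ?C) = ?C ! pos x"
    proof (rule hd_filter_nth)
      show "pos x < length ?C" using pos_less[OF xS] by simp
      show "head H (?C ! pos x) = crossing G x" using pos_less[OF xS] xS by (simp add: head_arc)
      fix j assume j: "j < pos x"
      then have jn: "j < n" using pos_less[OF xS] by simp
      show "head H (?C ! j) \<noteq> crossing G x"
      proof
        assume "head H (?C ! j) = crossing G x"
        then have "x = visit j \<or> x = \<alpha> (visit j)"
          using jn xS by (simp add: head_arc crossing_eq_iff)
        then have "visit j = x \<or> visit j = \<alpha> x" by auto
        then have "j = pos x \<or> j = pos (\<alpha> x)" using pos_visit[OF jn] by auto
        then show False using j x by (auto simp: first_darts_def)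
      qed
    qed
    then show ?thesis using pos_less[OF xS] xS by simp
  qed
  show ?thesis unfolding Psi_def Phi_eq crossings_of_first_darts image_image
    by (rule image_cong) (use first in simp_all)
qed

text \<open>The tour enters the crossing of a first dart from the crossing it visited one step before.\<close>

lemma crossing_ranked_tree:
  "ranked_tree (H\<lparr>arcs := arc ` (first_darts - {x0})\<rparr>) (crossing G x0) (tail H) (head H) (entry (crossing G))"
proof -
  have sub: "arc ` (first_darts - {x0}) \<subseteq> arc ` S" using first_darts_subset by blast
  interpret W: wf_digraph "H\<lparr>arcs := arc ` (first_darts - {x0})\<rparr>" by (rule wf_H[OF sub])
  show ?thesis
  proof
    show "crossing G x0 \<in> verts (H\<lparr>arcs := arc ` (first_darts - {x0})\<rparr>)" using x0_in by (simp add: verts_H)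
  next
    have "inj_on (head H) (arc ` (first_darts - {x0}))"
    proof (rule inj_onI)
      fix a b assume a: "a \<in> arc ` (first_darts - {x0})" and b: "b \<in> arc ` (first_darts - {x0})"
        and eq: "head H a = head H b"
      obtain x y where xy: "x \<in> first_darts" "y \<in> first_darts" "a = arc x" "b = arc y" using a b by blast
      then have S: "x \<in> S" "y \<in> S" using first_darts_subset by auto
      then have "y = x \<or> y = \<alpha> x" using eq xy by (simp add: head_arc crossing_eq_iff)
      then show "a = b" using xy first_darts_alt[OF S(1)] by auto
    qed
    moreover have "head H ` arc ` (first_darts - {x0}) = verts H - {crossing G x0}"
    proof -
      have "head H ` arc ` (first_darts - {x0}) = crossing G ` (first_darts - {x0})"
        unfolding image_image using first_darts_subset by (intro image_cong) (auto simp: head_arc)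
      also have "\<dots> = verts H - {crossing G x0}" by (rule crossings_of_first_darts[symmetric])
      finally show ?thesis .
    qed
    ultimately show "bij_betw (head H) (arcs (H\<lparr>arcs := arc ` (first_darts - {x0})\<rparr>))
       (verts (H\<lparr>arcs := arc ` (first_darts - {x0})\<rparr>) - {crossing G x0})"
      by (simp add: bij_betw_def)
  next
    fix a assume "a \<in> arcs (H\<lparr>arcs := arc ` (first_darts - {x0})\<rparr>)"
    then obtain x where x: "x \<in> first_darts" "x \<noteq> x0" "a = arc x" by auto
    have xS: "x \<in> S" using x(1) first_darts_subset by blast
    obtain y where y: "y \<in> S" "f y = x" "pos x = Suc (pos y)" using pred_ex[OF xS x(2)] by blast
    have "tail H a = crossing G y" using tail_arc_step[OF y(1)] y(2) x(3) by simp
    then have "entry (crossing G) (tail H a) < pos x"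
      using entry_le[OF y(1), of "crossing G"] y(3) by simp
    moreover have "pos x \<le> entry (crossing G) (crossing G x)"
    proof -
      obtain z where z: "z \<in> S" "crossing G z = crossing G x" "pos z = entry (crossing G) (crossing G x)"
        using entry_attained[of "crossing G x" "crossing G"] xS by blast
      then have "x = z \<or> x = \<alpha> z" using xS by (simp add: crossing_eq_iff)
      then have "z = x \<or> z = \<alpha> x" by auto
      then show ?thesis using z(3) x(1) by (auto simp: first_darts_def)
    qed
    ultimately show "entry (crossing G) (tail H a) < entry (crossing G) (head H a)"
      using x(3) xS by (simp add: head_arc)
  qed simp
qed

lemma first_darts_arborescence: "arc ` (first_darts - {x0}) \<in> arborescences H (crossing G x0)"
proof -
  let ?A = "arc ` (first_darts - {x0})"
  interpret R: ranked_tree "H\<lparr>arcs := ?A\<rparr>" "crossing G x0" "tail H" "head H" "entry (crossing G)"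
    by (rule crossing_ranked_tree)
  have "?A \<subseteq> arcs H" using first_darts_subset by (auto simp: arcs_H)
  then have "?A \<in> spanning_trees H"
    using R.connected R.forest by (simp add: spanning_trees_def)
  moreover have "\<exists>!p. pre_digraph.apath (H\<lparr>arcs := ?A\<rparr>) (crossing G x0) p u" if "u \<in> verts H" for u
    using R.ex1_apath_from_root[of u] that by simp
  ultimately show ?thesis by (simp add: arborescences_def)
qed

lemma wt_C_first_darts:
  "pcompose (wt_C G E (arc ` (first_darts - {x0}))) (- t_var) = t_var ^ card {x \<in> first_darts - {x0}. x \<notin> E}"
proof -
  let ?X = "first_darts - {x0}"
  have fin': "finite ?X" using first_darts_subset fin by (meson finite_Diff finite_subset)
  have "wt_C G E (arc ` ?X) = (\<Prod>x\<in>?X. var G E (arc x))"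
    unfolding wt_C_def by (subst prod.reindex) (simp_all add: inj_on_def)
  then have "pcompose (wt_C G E (arc ` ?X)) (- t_var) = (\<Prod>x\<in>?X. pcompose (var G E (arc x)) (- t_var))"
    by (simp only: pcompose_prod)
  also have "\<dots> = (\<Prod>x\<in>?X. if x \<notin> E then t_var else 1)"
  proof (rule prod.cong)
    fix x assume "x \<in> ?X"
    then have "x \<in> S" using first_darts_subset by blast
    then show "pcompose (var G E (arc x)) (- t_var) = (if x \<notin> E then t_var else 1)"
      by (simp add: var_arc pcompose_1 pcompose_pCons)
  qed simp
  also have "\<dots> = t_var ^ card {x \<in> ?X. x \<notin> E}"
    using fin' by (simp add: prod.If_cases Int_def)
  finally show ?thesis .
qed

end

section \<open>The first entries determine the tour\<close>

context alternating_plane_map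
begin

text \<open>If two tours agree after time \<open>i\<close> but are on opposite sides of the same crossing at time \<open>i\<close>, then the dart
\<open>y\<close> of the second tour cannot occur later in the first tour, where it would appear at the same time in
the second. So it occurs earlier, and it is a first entry of the first tour.\<close>

lemma swap_is_early:
  assumes A: "contour_tour G E T x0" and B: "contour_tour G E T' x0" and i: "i < card S"
    and agree: "\<And>j. \<lbrakk>i < j; j \<le> card S\<rbrakk> \<Longrightarrow> (contour_step T ^^ j) x0 = (contour_step T' ^^ j) x0"
    and swap: "(contour_step T ^^ i) x0 = \<alpha> ((contour_step T' ^^ i) x0)"
  shows "(contour_step T' ^^ i) x0 \<in> contour_tour.first_darts G T x0"
proof -
  interpret A: contour_tour G E T x0 by (rule A)
  interpret B: contour_tour G E T' x0 by (rule B)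
  let ?y = "(contour_step T' ^^ i) x0"
  have yS: "?y \<in> S" by (rule B.visit_in)
  have x: "A.pos (\<alpha> ?y) = i" using A.pos_visit[OF i] by (simp only: swap)
  define j where "j = A.pos ?y"
  have j: "j < card S" "(contour_step T ^^ j) x0 = ?y"
    using A.pos_less[OF yS] A.visit_pos[OF yS] by (simp_all add: j_def)
  have "\<not> i < j"
  proof
    assume "i < j"
    then have "(contour_step T' ^^ j) x0 = ?y"
      by (rule trans[OF agree[OF _ less_imp_le[OF j(1)], symmetric] j(2)])
    then have "B.pos ((contour_step T' ^^ j) x0) = B.pos ?y" by (rule arg_cong)
    then have "j = i" unfolding B.pos_visit[OF j(1)] B.pos_visit[OF i] .
    then show False using \<open>i < j\<close> by simp
  qed
  moreover have "j \<noteq> i"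
  proof
    assume "j = i"
    then have "\<alpha> ?y = ?y" using j(2) by (simp only: swap)
    then show False using opp_neq[OF yS] by simp
  qed
  ultimately have "A.pos ?y < A.pos (\<alpha> ?y)" unfolding x j_def[symmetric] by simp
  then show ?thesis using yS by (simp add: A.first_darts_def)
qed

text \<open>At the last disagreement the tours are on opposite sides of one crossing, so by \<open>swap_is_early\<close> both
darts of its edge would be first entries.\<close>

lemma tours_agree:
  assumes A: "contour_tour G E T x0" and B: "contour_tour G E T' x0"
    and same: "contour_tour.first_darts G T x0 = contour_tour.first_darts G T' x0" and i: "i \<le> card S"
  shows "(contour_step T ^^ i) x0 = (contour_step T' ^^ i) x0"
proof (rule ccontr)
  interpret A: contour_tour G E T x0 by (rule A)
  interpret B: contour_tour G E T' x0 by (rule B)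
  let ?u = "\<lambda>i. (contour_step T ^^ i) x0" and ?w = "\<lambda>i. (contour_step T' ^^ i) x0"
  define bad where "bad = {i. i \<le> card S \<and> ?u i \<noteq> ?w i}"
  assume "?u i \<noteq> ?w i"
  then have ne: "bad \<noteq> {}" "finite bad" using i by (auto simp: bad_def)
  define m where "m = Max bad"
  have "m \<in> bad" unfolding m_def using ne by (intro Max_in) auto
  then have m: "m \<le> card S" "?u m \<noteq> ?w m" by (auto simp: bad_def)
  have above: "?u j = ?w j" if "m < j" "j \<le> card S" for j
  proof (rule ccontr)
    assume "?u j \<noteq> ?w j"
    then have "j \<in> bad" using that by (simp add: bad_def)
    then have "j \<le> m" unfolding m_def using ne by (intro Max_ge) auto
    then show False using that by simp
  qed
  have "m \<noteq> card S" using m A.visits(3) B.visits(3) by auto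
  then have mn: "m < card S" using m(1) by simp
  then have "?u (Suc m) = ?w (Suc m)" by (intro above) simp_all
  then have "\<sigma> (contour_step T (?u m)) = \<sigma> (contour_step T' (?w m))" by simp
  then have swap: "?u m = \<alpha> (?w m)"
    using m(2) unfolding rot_contour_step by (auto split: if_splits) (metis opp_opp)+
  then have swap': "?w m = \<alpha> (?u m)" by simp
  have "?w m \<in> A.first_darts" by (rule swap_is_early[OF A B mn above swap])
  moreover have "?u m \<in> B.first_darts" by (rule swap_is_early[OF B A mn above[symmetric] swap'])
  ultimately show False using A.first_darts_alt[OF B.visit_in[of m]] swap same by simp
qed

lemma contour_determined_by_first_darts:
  assumes A: "contour_tour G E T x0" and B: "contour_tour G E T' x0"
    and same: "contour_tour.first_darts G T x0 = contour_tour.first_darts G T' x0"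
  shows "T = T'"
proof -
  have sub: "T \<subseteq> T'" if A: "contour_tour G E T x0" and B: "contour_tour G E T' x0"
    and same: "contour_tour.first_darts G T x0 = contour_tour.first_darts G T' x0" for T T'
  proof
    interpret A: contour_tour G E T x0 by (rule A)
    interpret B: contour_tour G E T' x0 by (rule B)
    fix e assume e: "e \<in> T"
    then have eE: "e \<in> E" using A.T_E by blast
    then have eS: "e \<in> S" using E_darts by blast
    have le: "A.pos e \<le> card S" "Suc (A.pos e) \<le> card S" using A.pos_less[OF eS] by simp_all
    have at_e: "(contour_step T' ^^ A.pos e) x0 = e"
      by (rule trans[OF tours_agree[OF A B same le(1), symmetric] A.visit_pos[OF eS]])
    have "contour_step T e = contour_step T' e"
      using tours_agree[OF A B same le(2)] by (simp only: funpow.simps o_apply at_e A.visit_pos[OF eS])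
    then have "\<sigma> (contour_step T e) = \<sigma> (contour_step T' e)" by simp
    then have "e \<in> T' \<or> \<alpha> e \<in> T'"
      using e opp_neq[OF eS] unfolding rot_contour_step by (auto split: if_splits)
    moreover have "\<alpha> e \<notin> T'" using B.T_E opp_in_E[OF eS] eE by blast
    ultimately show "e \<in> T'" by blast
  qed
  show ?thesis using sub[OF A B same] sub[OF B A same[symmetric]] by (rule subset_antisym)
qed

end

section \<open>Every arborescence comes from a tour\<close>

locale crowell_arborescence = alternating_plane_map G E for G :: "'a cmap" and E +
  fixes x0 :: 'a and A :: "('a \<times> side) set"
  assumes x0_in: "x0 \<in> S" and A: "A \<in> arborescences H (crossing G x0)"
begin

sublocale arborescence H "crossing G x0" A
  by (rule arborescence.intro[OF wf_crowell _ A]) (simp add: verts_H x0_in)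

text \<open>The set that is to become \<open>first_darts\<close>. The starting dart is included because the root has no arc of
the arborescence entering it, but is visited first through \<open>x0\<close>.\<close>

definition early :: "'a set" where "early = insert x0 {x \<in> S. arc x \<in> A}"

lemma early_S: "early \<subseteq> S" using x0_in by (auto simp: early_def)

lemma not_into_root: "x \<in> S \<Longrightarrow> arc x \<in> A \<Longrightarrow> x \<noteq> x0 \<and> x \<noteq> \<alpha> x0"
  using no_arc_into_root[of "arc x"] x0_in by (auto simp: head_arc)

lemma A_eq: "A = arc ` (early - {x0})"
proof
  show "A \<subseteq> arc ` (early - {x0})"
  proof
    fix a assume a: "a \<in> A"
    then obtain x where x: "x \<in> S" "a = arc x" using A_arcs arcs_H by blast
    then show "a \<in> arc ` (early - {x0})" using a not_into_root[of x] by (auto simp: early_def)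
  qed
qed (auto simp: early_def)

lemma early_alt:
  assumes x: "x \<in> S"
  shows "\<alpha> x \<in> early \<longleftrightarrow> x \<notin> early"
proof (cases "crossing G x = crossing G x0")
  case True
  then have "x = x0 \<or> x = \<alpha> x0" using x x0_in by (auto simp: crossing_eq_iff)
  moreover have "\<alpha> x0 \<notin> early"
    using not_into_root[of "\<alpha> x0"] opp_neq[OF x0_in] x0_in by (auto simp: early_def)
  moreover have "x0 \<in> early" by (simp add: early_def)
  ultimately show ?thesis by auto
next
  case False
  then have ne: "x \<noteq> x0" "\<alpha> x \<noteq> x0" using x by auto
  have "crossing G x \<in> verts H" using x by (simp add: verts_H)
  then obtain a where a: "a \<in> A" "head H a = crossing G x" using arc_into False by blast
  obtain y where y: "y \<in> S" "a = arc y" using a(1) A_arcs arcs_H by blast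
  then have "y = x \<or> y = \<alpha> x" using a(2) x by (auto simp: head_arc crossing_eq_iff)
  then have some: "arc x \<in> A \<or> arc (\<alpha> x) \<in> A" using a(1) y(2) by auto
  have "\<not> (arc x \<in> A \<and> arc (\<alpha> x) \<in> A)"
  proof
    assume both: "arc x \<in> A \<and> arc (\<alpha> x) \<in> A"
    have "head H (arc x) = head H (arc (\<alpha> x))" using x by (simp add: head_arc)
    then have "arc x = arc (\<alpha> x)" using head_inj both by blast
    then show False using opp_neq[OF x] by simp
  qed
  then show ?thesis using some ne x by (auto simp: early_def)
qed

text \<open>The tour traced against its direction from the starting dart, with \<open>y i\<close> visited \<open>i\<close> steps before the end.
Each step leads back to one of the two darts at the crossing from which \<open>y i\<close> is reached, and early darts may be
used only after their opposites. The start \<open>y 0\<close> and the end of a closed walk coincide, hence the two injectivity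
conditions.\<close>

definition backward_walk :: "(nat \<Rightarrow> 'a) \<Rightarrow> nat \<Rightarrow> bool" where
  "backward_walk y k \<longleftrightarrow> y 0 = x0 \<and> (\<forall>i\<le>k. y i \<in> S)
     \<and> inj_on y {1..k} \<and> inj_on y {0..<k}
     \<and> (\<forall>i<k. y (Suc i) = \<sigma> (y i) \<or> y (Suc i) = \<alpha> (\<sigma> (y i)))
     \<and> (\<forall>i\<in>{1..k}. y i \<in> early \<longrightarrow> (\<exists>j\<in>{1..<i}. y j = \<alpha> (y i)))"

lemma backward_walk_extend:
  assumes w: "backward_walk y k" and b: "b = \<sigma> (y k) \<or> b = \<alpha> (\<sigma> (y k))"
    and new: "b \<notin> y ` {1..k}" and inj: "inj_on y {0..k}"
    and early: "b \<in> early \<Longrightarrow> \<alpha> b \<in> y ` {1..k}"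
  shows "backward_walk (y(Suc k := b)) (Suc k)"
proof -
  let ?z = "y(Suc k := b)"
  have old: "?z i = y i" if "i \<le> k" for i using that by simp
  have S: "\<forall>i\<le>k. y i \<in> S" and step: "\<forall>i<k. y (Suc i) = \<sigma> (y i) \<or> y (Suc i) = \<alpha> (\<sigma> (y i))"
    and pre: "\<forall>i\<in>{1..k}. y i \<in> early \<longrightarrow> (\<exists>j\<in>{1..<i}. y j = \<alpha> (y i))" and inj1: "inj_on y {1..k}"
    and y0: "y 0 = x0"
    using w by (auto simp: backward_walk_def)
  have bS: "b \<in> S" using b S by auto
  have "inj_on ?z {1..k}" using inj1 by (subst inj_on_cong[of _ _ y]) auto
  moreover have "b \<notin> ?z ` {1..k}" using new by (auto simp: image_iff)
  moreover have "{1..Suc k} = insert (Suc k) {1..k}" by auto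
  ultimately have i1: "inj_on ?z {1..Suc k}" by auto
  have "inj_on ?z {0..k}" using inj by (subst inj_on_cong[of _ _ y]) auto
  then have i2: "inj_on ?z {0..<Suc k}" by (simp add: atLeastLessThanSuc_atLeastAtMost)
  have s: "?z (Suc i) = \<sigma> (?z i) \<or> ?z (Suc i) = \<alpha> (\<sigma> (?z i))" if "i < Suc k" for i
    using that step b by (cases "i = k") auto
  have e: "\<exists>j\<in>{1..<i}. ?z j = \<alpha> (?z i)" if i: "i \<in> {1..Suc k}" "?z i \<in> early" for i
  proof (cases "i = Suc k")
    case True
    then obtain j where "j \<in> {1..k}" "y j = \<alpha> b" using early i(2) by force
    then show ?thesis using True by (intro bexI[of _ j]) auto
  next
    case False
    then have ik: "i \<in> {1..k}" using i(1) by auto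
    then obtain j where "j \<in> {1..<i}" "y j = \<alpha> (y i)" using pre i(2) by auto
    then show ?thesis using ik by (intro bexI[of _ j]) auto
  qed
  show ?thesis
    unfolding backward_walk_def using y0 S bS i1 i2 s e by (auto simp: le_Suc_eq)
qed

text \<open>The walk is about to enter a crossing \<open>{b, \<alpha> b}\<close>, where \<open>b\<close> is the dart that is not early. Each previous
visit to this crossing used up one of its two outgoing arcs, and so does the present one; so there was at
most one previous visit and \<open>b\<close> or \<open>\<alpha> b\<close> is still available.\<close>

lemma backward_walk_extendable:
  assumes w: "backward_walk y k" and stop: "k = 0 \<or> y k \<noteq> x0"
  shows "\<exists>z. backward_walk z (Suc k)"
proof -
  have S: "\<forall>i\<le>k. y i \<in> S" and step: "\<forall>i<k. y (Suc i) = \<sigma> (y i) \<or> y (Suc i) = \<alpha> (\<sigma> (y i))"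
    and inj1: "inj_on y {1..k}" and inj0: "inj_on y {0..<k}" and y0: "y 0 = x0"
    using w by (auto simp: backward_walk_def)
  \<comment> \<open>the walk has not returned to \<open>x0\<close>, so \<open>y 0\<close> differs from all later darts\<close>
  have inj: "inj_on y {0..k}"
  proof (cases "k = 0")
    case False
    have "y 0 \<notin> y ` {1..k}"
    proof
      assume "y 0 \<in> y ` {1..k}"
      then obtain i where i: "i \<in> {1..k}" "y i = y 0" by force
      then have "i \<noteq> k" using stop False y0 by auto
      then have "i = 0" using inj_onD[OF inj0 i(2)] i(1) by auto
      then show False using i(1) by simp
    qed
    moreover have "{0..k} = insert 0 {1..k}" by auto
    ultimately show ?thesis using inj1 by auto
  qed simp
  have kS: "\<sigma> (y k) \<in> S" using S by simp
  then obtain b where b: "b = \<sigma> (y k) \<or> b = \<alpha> (\<sigma> (y k))" "b \<notin> early" using early_alt by blast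
  show ?thesis
  proof (cases "b \<in> y ` {1..k}")
    case False
    from backward_walk_extend[OF w b(1) this inj] b(2) show ?thesis by blast
  next
    case True
    have "\<alpha> b \<notin> y ` {1..k}"
    proof
      assume "\<alpha> b \<in> y ` {1..k}"
      then obtain l where l: "l \<in> {1..k}" "y l = \<alpha> b" by force
      obtain j where j: "j \<in> {1..k}" "y j = b" using True by force
      have "b \<in> S" using b(1) kS by auto
      then have "j \<noteq> l" using j l opp_neq[of b] by auto
      have dep: "\<sigma> (y (i - 1)) = b \<or> \<sigma> (y (i - 1)) = \<alpha> b" if i: "i \<in> {1..k}" "y i = b \<or> y i = \<alpha> b" for i
      proof -
        have "y (Suc (i - 1)) = \<sigma> (y (i - 1)) \<or> y (Suc (i - 1)) = \<alpha> (\<sigma> (y (i - 1)))"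
          using step[rule_format, of "i - 1"] i(1) by fastforce
        then have "y i = \<sigma> (y (i - 1)) \<or> y i = \<alpha> (\<sigma> (y (i - 1)))" using i(1) by simp
        then show ?thesis using i(2) by auto
      qed
      have 3: "\<sigma> (y k) = b \<or> \<sigma> (y k) = \<alpha> b" using b(1) by auto
      have "y (j - 1) \<noteq> y (l - 1)" "y (j - 1) \<noteq> y k" "y (l - 1) \<noteq> y k"
        using inj j(1) l(1) \<open>j \<noteq> l\<close> by (auto simp: inj_on_eq_iff)
      then have "\<sigma> (y (j - 1)) \<noteq> \<sigma> (y (l - 1))" "\<sigma> (y (j - 1)) \<noteq> \<sigma> (y k)" "\<sigma> (y (l - 1)) \<noteq> \<sigma> (y k)"
        by simp_all
      \<comment> \<open>three distinct darts cannot all leave from a crossing that carries two\<close>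
      then show False using dep[of j] dep[of l] j l 3 by metis
    qed
    moreover have "\<alpha> b = \<sigma> (y k) \<or> \<alpha> b = \<alpha> (\<sigma> (y k))" using b(1) by auto
    ultimately show ?thesis using backward_walk_extend[OF w _ _ inj, of "\<alpha> b"] True by auto
  qed
qed

text \<open>A walk of maximal length cannot be extended.\<close>

lemma closed_backward_walk: "\<exists>y k. backward_walk y k \<and> 0 < k \<and> y k = x0"
proof -
  have bound: "k \<le> card S" if "backward_walk y k" for y k
  proof -
    have "inj_on y {1..k}" "y ` {1..k} \<subseteq> S" using that by (auto simp: backward_walk_def)
    from card_inj_on_le[OF this fin] show ?thesis by simp
  qed
  have "backward_walk (\<lambda>_. x0) 0" using x0_in by (simp add: backward_walk_def)
  then have zero: "\<exists>y. backward_walk y 0"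
    by (rule exI[of "\<lambda>y. backward_walk y 0" "\<lambda>_. x0"])
  have bdd: "l \<le> card S" if "\<exists>y. backward_walk y l" for l using that bound by (elim exE)
  define k where "k = (GREATEST k. \<exists>y. backward_walk y k)"
  have k: "\<exists>y. backward_walk y k"
    unfolding k_def by (rule GreatestI_nat[where P = "\<lambda>k. \<exists>y. backward_walk y k", OF zero bdd])
  have max: "l \<le> k" if "\<exists>y. backward_walk y l" for l
    unfolding k_def by (rule Greatest_le_nat[where P = "\<lambda>k. \<exists>y. backward_walk y k", OF that bdd])
  obtain y where y: "backward_walk y k" using k by blast
  have "\<not> (k = 0 \<or> y k \<noteq> x0)"
  proof
    assume "k = 0 \<or> y k \<noteq> x0"
    then have "Suc k \<le> k" using backward_walk_extendable[OF y] max by blast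
    then show False by simp
  qed
  then have "0 < k" "y k = x0" by simp_all
  with y show ?thesis by (intro exI conjI)
qed

text \<open>Call a crossing full if both its darts have been visited. The root is full, since the walk ended with its early
dart. If the tail of an arc of the arborescence is full, then the walk has passed it twice and therefore has used
both arcs leaving it, in particular this one. So it visited the early dart at the head, and before that its
opposite: the head is full as well.\<close>

lemma closed_backward_walk_full:
  assumes w: "backward_walk y k" and k: "0 < k" "y k = x0"
  shows "y ` {1..k} = S"
proof -
  have S: "\<forall>i\<le>k. y i \<in> S" and step: "\<forall>i<k. y (Suc i) = \<sigma> (y i) \<or> y (Suc i) = \<alpha> (\<sigma> (y i))"
    and inj1: "inj_on y {1..k}"
    and pre: "\<forall>i\<in>{1..k}. y i \<in> early \<longrightarrow> (\<exists>j\<in>{1..<i}. y j = \<alpha> (y i))" and inj0: "inj_on y {0..<k}"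
    and y0: "y 0 = x0"
    using w by (auto simp: backward_walk_def)
  define Y where "Y = y ` {1..k}"
  have Y0: "y m \<in> Y" if "m < k" for m
  proof (cases "m = 0")
    case True
    then have "y m = y k" using y0 k by simp
    then show ?thesis using k(1) by (auto simp: Y_def)
  qed (use that in \<open>auto simp: Y_def\<close>)
  have Ypre: "\<alpha> x \<in> Y" if x: "x \<in> Y" "x \<in> early" for x
  proof -
    obtain i where i: "i \<in> {1..k}" "x = y i" using x(1) by (auto simp: Y_def)
    then obtain j where "j \<in> {1..<i}" "y j = \<alpha> x" using pre x(2) by blast
    then show ?thesis using i unfolding Y_def by (intro image_eqI[of _ _ j]) auto
  qed
  have full_step: "x \<in> Y \<and> \<alpha> x \<in> Y"
    if x: "x \<in> S" "x \<in> early" and full: "\<sigma> x \<in> Y" "\<alpha> (\<sigma> x) \<in> Y" for x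
  proof -
    let ?d = "\<sigma> x"
    obtain i j where i: "i \<in> {1..k}" "y i = ?d" and j: "j \<in> {1..k}" "y j = \<alpha> ?d"
      using full unfolding Y_def by (metis imageE)
    have "i \<noteq> j" using i j opp_neq[of ?d] x(1) by auto
    have dep: "\<sigma> (y (l - 1)) = ?d \<or> \<sigma> (y (l - 1)) = \<alpha> ?d"
      if l: "l \<in> {1..k}" "y l = ?d \<or> y l = \<alpha> ?d" for l
    proof -
      have "y (Suc (l - 1)) = \<sigma> (y (l - 1)) \<or> y (Suc (l - 1)) = \<alpha> (\<sigma> (y (l - 1)))"
        using step[rule_format, of "l - 1"] l(1) by fastforce
      then have "y l = \<sigma> (y (l - 1)) \<or> y l = \<alpha> (\<sigma> (y (l - 1)))" using l(1) by simp
      then show ?thesis using l(2) by auto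
    qed
    have "i - 1 \<in> {0..<k}" "j - 1 \<in> {0..<k}" "i - 1 \<noteq> j - 1" using i(1) j(1) \<open>i \<noteq> j\<close> by auto
    then have ne: "y (i - 1) \<noteq> y (j - 1)" using inj_onD[OF inj0] by blast
    then have "\<sigma> (y (i - 1)) \<noteq> \<sigma> (y (j - 1))" by simp
    then have "\<sigma> (y (i - 1)) = ?d \<or> \<sigma> (y (j - 1)) = ?d" using dep[of i] dep[of j] i j by metis
    then have "y (i - 1) = x \<or> y (j - 1) = x" by simp
    then have "x \<in> Y" using Y0[of "i - 1"] Y0[of "j - 1"] i(1) j(1) by auto
    then show ?thesis using Ypre x(2) by blast
  qed
  have root: "x0 \<in> Y \<and> \<alpha> x0 \<in> Y"
  proof -
    have "x0 \<in> Y" using Y0[OF k(1)] y0 by simp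
    then show ?thesis using Ypre[of x0] by (simp add: early_def)
  qed
  have "x \<in> Y" if x: "x \<in> S" for x
  proof -
    have "crossing G x \<in> verts H" using x by (simp add: verts_H)
    then have "\<forall>z\<in>S. crossing G z = crossing G x \<longrightarrow> z \<in> Y"
    proof (induction rule: root_induct)
      case root
      then show ?case using \<open>x0 \<in> Y \<and> \<alpha> x0 \<in> Y\<close> x0_in by (auto simp: crossing_eq_iff)
    next
      case (arc a)
      obtain z where z: "z \<in> S" "a = arc z" using arc.hyps(1) A_arcs arcs_H by blast
      have "z \<in> early" using z arc.hyps(1) by (simp add: early_def)
      moreover have "\<sigma> z \<in> Y" "\<alpha> (\<sigma> z) \<in> Y" using arc.IH z by (auto simp: tail_arc)
      ultimately have "z \<in> Y \<and> \<alpha> z \<in> Y" using full_step z(1) by blast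
      then show ?case using z by (auto simp: head_arc crossing_eq_iff)
    qed
    then show ?thesis using x by blast
  qed
  moreover have "Y \<subseteq> S" using S by (auto simp: Y_def)
  ultimately show ?thesis unfolding Y_def by blast
qed

text \<open>The backward walk prescribes at every crossing whether the tour stays at its vertex of \<open>G\<close>, and the edges
of \<open>T\<close> are those where it does. Both passages through a crossing agree on this because they use
different darts.\<close>

lemma arborescence_from_tour:
  "\<exists>T. contour_tour G E T x0 \<and> A = arc ` (contour_tour.first_darts G T x0 - {x0})"
proof -
  obtain y k where w: "backward_walk y k" and k: "0 < k" "y k = x0"
    using closed_backward_walk by blast
  have S: "\<forall>i\<le>k. y i \<in> S" and step: "\<forall>i<k. y (Suc i) = \<sigma> (y i) \<or> y (Suc i) = \<alpha> (\<sigma> (y i))"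
    and inj1: "inj_on y {1..k}"
    and pre: "\<forall>i\<in>{1..k}. y i \<in> early \<longrightarrow> (\<exists>j\<in>{1..<i}. y j = \<alpha> (y i))" and inj0: "inj_on y {0..<k}"
    and y0: "y 0 = x0"
    using w by (auto simp: backward_walk_def)
  have full: "y ` {1..k} = S" by (rule closed_backward_walk_full[OF w k])
  \<comment> \<open>the walk and the contour run in opposite directions, so time \<open>i\<close> of one is \<open>k - i\<close> of the other\<close>
  have card: "card S = k" using card_image[OF inj1] full by simp
  define T where "T = {e \<in> E. \<exists>i<k. y (Suc i) = \<sigma> (y i) \<and> (e = y (Suc i) \<or> \<alpha> e = y (Suc i))}"
  have TE: "T \<subseteq> E" by (auto simp: T_def)
  have retrace: "contour_step T (y (Suc i)) = y i" if i: "i < k" for i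
  proof (cases "y (Suc i) = \<sigma> (y i)")
    case True
    have "y (Suc i) \<in> S" using S i by simp
    then have "y (Suc i) \<in> E \<or> \<alpha> (y (Suc i)) \<in> E" using opp_in_E by blast
    then have "y (Suc i) \<in> T \<or> \<alpha> (y (Suc i)) \<in> T" using True i by (auto simp: T_def)
    then show ?thesis using True by (simp add: contour_step_def)
  next
    case False
    then have y: "y (Suc i) = \<alpha> (\<sigma> (y i))" using step i by blast
    have "\<not> (y (Suc i) \<in> T \<or> \<alpha> (y (Suc i)) \<in> T)"
    proof
      assume "y (Suc i) \<in> T \<or> \<alpha> (y (Suc i)) \<in> T"
      then obtain j where j: "j < k" "y (Suc j) = \<sigma> (y j)"
        "y (Suc j) = y (Suc i) \<or> y (Suc j) = \<alpha> (y (Suc i))"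
        by (auto simp: T_def)
      from j(3) have "j = i"
      proof
        assume "y (Suc j) = y (Suc i)"
        then have "Suc j = Suc i" by (rule inj_onD[OF inj1]) (use j(1) i in auto)
        then show ?thesis by simp
      next
        assume "y (Suc j) = \<alpha> (y (Suc i))"
        then have "y j = y i" using j(2) y by simp
        then show ?thesis by (rule inj_onD[OF inj0]) (use j(1) i in auto)
      qed
      then show False using j(2) False by simp
    qed
    then show ?thesis using y by (simp add: contour_step_def face_perm_def)
  qed
  have visit: "(contour_step T ^^ i) x0 = y (k - i)" if "i \<le> k" for i
    using that
  proof (induction i)
    case (Suc i)
    have "k - i = Suc (k - Suc i)" using Suc.prems by simp
    then show ?case using Suc retrace[of "k - Suc i"] by simp
  qed (simp add: k)
  have "orbit (contour_step T) x0 = S"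
  proof
    show "orbit (contour_step T) x0 \<subseteq> S"
      by (rule permutes_orbit_subset[OF contour_step_permutes[OF TE] x0_in])
    show "S \<subseteq> orbit (contour_step T) x0"
    proof
      fix x assume "x \<in> S"
      then obtain i where i: "i \<in> {1..k}" "x = y i" using full by blast
      have perm: "permutation (contour_step T)"
        using contour_step_permutes[OF TE] fin by (auto simp: permutation_permutes)
      have "x = (contour_step T ^^ (k - i)) x0" using visit[of "k - i"] i by simp
      then show "x \<in> orbit (contour_step T) x0"
        using funpow_in_orbit[OF permutation_self_in_orbit[OF perm]] by simp
    qed
  qed
  then have tour: "contour_tour G E T x0"
    using TE x0_in by unfold_locales
  interpret C: contour_tour G E T x0 by (rule tour)
  have pos: "C.pos (y i) = k - i" if "i \<in> {1..k}" for i
    using C.pos_visit[of "k - i"] visit[of "k - i"] that card by simp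
  have sub: "x \<in> C.first_darts" if x: "x \<in> early" for x
  proof -
    have "x \<in> S" using x early_S by blast
    then obtain i where i: "i \<in> {1..k}" "x = y i" using full by blast
    then obtain j where j: "j \<in> {1..<i}" "y j = \<alpha> x" using pre x by blast
    then have "C.pos (\<alpha> x) = k - j" "C.pos x = k - i" using pos[of j] pos[of i] i by auto
    then show ?thesis using i j \<open>x \<in> S\<close> by (auto simp: C.first_darts_def)
  qed
  have first_darts_eq: "C.first_darts = early"
  proof
    show "C.first_darts \<subseteq> early"
    proof
      fix x assume x: "x \<in> C.first_darts"
      then have xS: "x \<in> S" using C.first_darts_subset by blast
      show "x \<in> early"
      proof (rule ccontr)
        assume "x \<notin> early"
        then have "\<alpha> x \<in> early" using early_alt[OF xS] by blast
        then show False using sub C.first_darts_alt[OF xS] x by blast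
      qed
    qed
  qed (use sub in blast)
  have "A = arc ` (C.first_darts - {x0})" unfolding first_darts_eq by (rule A_eq)
  with tour show ?thesis by (intro exI conjI)
qed

end

section \<open>The bijection\<close>

theorem theorem6p7:
  fixes G :: "'a cmap" and E :: "'a set" and r :: "'a set" and e0 :: 'a
    and f_v :: "'a \<times> side" and v :: "('a \<times> side) set"
    and D :: "('a set, 'a) pre_digraph"
    and H :: "(('a \<times> side) set, 'a \<times> side) pre_digraph"
  assumes "plane_map G" and "bipartite_map G"
    and "alternating_dimap (dual_map G) E"
    and "D = map_digraph (dual_map G) E"
    and "H = crowell_digraph G E"
    and "r \<in> verts D"
    and "e0 \<in> arcs D" and "head D e0 = r"
    and "v = crossing G e0"
    and "f_v \<in> boundary_arcs G E (D_region G r)" and "head H f_v = v"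
  shows "Phi G E f_v \<in> spanning_trees D \<rightarrow> euler_tours_from H f_v
    \<and> bij_betw (Psi H v \<circ> Phi G E f_v) (spanning_trees D) (arborescences H v)
    \<and> (\<forall>T\<in>spanning_trees D. \<forall>A. A = (Psi H v \<circ> Phi G E f_v) T \<longrightarrow>
         pcompose (wt_C G E A) (- t_var)
           = wt_K D r T * t_var ^ (card (blue_regions G E) - 1))"
proof -
  interpret P: alternating_plane_map G E using assms(1,3) by unfold_locales
  have e0: "e0 \<in> E" using assms(4,7) P.arcs_D by simp
  have "f_v \<in> crowell_arcs G E" using assms(10) by (simp add: boundary_arcs_def)
  then obtain x0 where x0: "x0 \<in> P.S" "f_v = P.arc x0" by (auto simp: P.crowell_arcs_eq)
  have v: "v = crossing G x0" using assms(5,11) x0 P.head_arc by simp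
  \<comment> \<open>the exterior region lies in the corner between \<open>x0\<close> and \<open>\<sigma> x0\<close>, through which the tour starts\<close>
  have r: "r = face G x0"
  proof -
    have "P.arc x0 \<in> D_region G r"
      using assms(10) x0 P.opp_arc[OF x0(1)] by (auto simp: boundary_arcs_def D_region_def)
    then obtain d where d: "d \<in> r" "rot G x0 = opp G d" by (auto simp: P.arc_def D_region_def)
    obtain x where x: "r = face G x" using assms(4,6) P.verts_D by (auto simp: faces_def)
    have "d \<in> orbit (face_perm G) x" using d(1) x by (simp add: face_def)
    then have "face G d = face G x" by induction simp_all
    moreover have "face_perm G d = x0"
      using arg_cong[OF d(2), of "inv (rot G)"] by (simp add: face_perm_def)
    then have "face G x0 = face G d" using P.face_phi[of d] by simp
    ultimately show ?thesis using x by simp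
  qed
  have tour: "contour_tour G E T x0" if "T \<in> spanning_trees D" for T
    using that P.spanning_tree_contour_cyclic[of T x0] x0(1) assms(4) P.arcs_D
    by unfold_locales (auto simp: spanning_trees_def)
  have F: "(Psi H v \<circ> Phi G E f_v) T = P.arc ` (contour_tour.first_darts G T x0 - {x0})"
    if "T \<in> spanning_trees D" for T
    using contour_tour.Psi_Phi[OF tour[OF that]] assms(5) v x0(2) by simp
  have 1: "Phi G E f_v \<in> spanning_trees D \<rightarrow> euler_tours_from H f_v"
    using contour_tour.Phi_euler[OF tour] assms(5) x0(2) by blast
  have 2: "bij_betw (Psi H v \<circ> Phi G E f_v) (spanning_trees D) (arborescences H v)"
    unfolding bij_betw_def
  proof
    show "inj_on (Psi H v \<circ> Phi G E f_v) (spanning_trees D)"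
    proof (rule inj_onI)
      fix T T' assume T: "T \<in> spanning_trees D" and T': "T' \<in> spanning_trees D"
        and eq: "(Psi H v \<circ> Phi G E f_v) T = (Psi H v \<circ> Phi G E f_v) T'"
      have "P.arc ` (contour_tour.first_darts G T x0 - {x0}) = P.arc ` (contour_tour.first_darts G T' x0 - {x0})"
        using eq by (simp only: F[OF T] F[OF T'])
      then have "contour_tour.first_darts G T x0 - {x0} = contour_tour.first_darts G T' x0 - {x0}"
        by (subst (asm) inj_image_eq_iff) (simp_all add: inj_on_def)
      then have "contour_tour.first_darts G T x0 = contour_tour.first_darts G T' x0"
        using contour_tour.x0_first[OF tour[OF T]] contour_tour.x0_first[OF tour[OF T']] by blast
      then show "T = T'" by (rule P.contour_determined_by_first_darts[OF tour[OF T] tour[OF T']])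
    qed
    show "(Psi H v \<circ> Phi G E f_v) ` spanning_trees D = arborescences H v"
    proof
      show "(Psi H v \<circ> Phi G E f_v) ` spanning_trees D \<subseteq> arborescences H v"
      proof
        fix A assume "A \<in> (Psi H v \<circ> Phi G E f_v) ` spanning_trees D"
        then obtain T where T: "T \<in> spanning_trees D" "A = (Psi H v \<circ> Phi G E f_v) T" by blast
        show "A \<in> arborescences H v"
          using contour_tour.first_darts_arborescence[OF tour[OF T(1)]] F[OF T(1)] T(2) assms(5) v by simp
      qed
      show "arborescences H v \<subseteq> (Psi H v \<circ> Phi G E f_v) ` spanning_trees D"
      proof
        fix A assume "A \<in> arborescences H v"
        then interpret crowell_arborescence G E x0 A
          using x0(1) assms(5) v by unfold_locales simp_all
        obtain T where T: "contour_tour G E T x0" "A = P.arc ` (contour_tour.first_darts G T x0 - {x0})"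
          using arborescence_from_tour by blast
        have "T \<in> spanning_trees D" using contour_tour.T_spanning[OF T(1)] assms(4) by simp
        then show "A \<in> (Psi H v \<circ> Phi G E f_v) ` spanning_trees D" using F T(2) by blast
      qed
    qed
  qed
  have 3: "pcompose (wt_C G E ((Psi H v \<circ> Phi G E f_v) T)) (- t_var)
      = wt_K D r T * t_var ^ (card (blue_regions G E) - 1)" if T: "T \<in> spanning_trees D" for T
  proof -
    have "E \<noteq> {}" using e0 by blast
    from contour_tour.card_class_A_entries[OF tour[OF T] this] contour_tour.wt_C_first_darts[OF tour[OF T]]
    show ?thesis unfolding F[OF T] wt_K_def r assms(4) P.card_blue_regions by (simp only: power_add)
  qed
  show ?thesis using 1 2 3 by blast
qed

end
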